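(* Let $n\ge 1$, let $\Phi$ be a nonnegative measurable function on $\mathbb{R}^n$, and let $k\geq 0$ be an integer. Let $H_{\Phi}f(x)=\int_{\mathbb{R}^n}\Phi(y)f\left(\frac{x}{|y|}\right)\mathrm{d}y$. Then $H_{\Phi}$ is bounded on $W^{k,1}(\mathbb{R}^n)$ if and only if $$\int_{\mathbb{R}^n}|y|^n\left(1+|y|^{-k}\right)\Phi(y)\,\mathrm{d}y<\infty .$$ Furthermore, if this integral is finite, then for every $f\in W^{k,1}(\mathbb{R}^n)$ and every multi-index $\alpha$ with $|\alpha|\le k$, the weak derivative satisfies $$D^{\alpha}(H_{\Phi}f)(x)=\int_{\mathbb{R}^n}|y|^{-|\alpha|}\Phi(y)\,(D^{\alpha}f)\left(\frac{x}{|y|}\right)\mathrm{d}y$$ for almost every $x$.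
   Context: For an integer $k\ge 0$, $W^{k,1}(\mathbb{R}^n)$ is the space of $f\in L^1(\mathbb{R}^n)$ whose weak derivatives $D^\alpha f$ exist and belong to $L^1(\mathbb{R}^n)$ for all $|\alpha|\le k$, with norm $\|f\|_{W^{k,1}}=\sum_{|\alpha|\le k}\|D^\alpha f\|_{L^1}$ (so $W^{0,1}=L^1$). Here $|y|$ is the Euclidean norm and $|\alpha|=\alpha_1+\cdots+\alpha_n$. "$H_\Phi$ is bounded on $W^{k,1}(\mathbb{R}^n)$" means that for each $f\in W^{k,1}(\mathbb{R}^n)$ the integral defining $H_\Phi f(x)$ converges absolutely for almost every $x$, and there is a constant $C$ with $\|H_\Phi f\|_{W^{k,1}}\le C\|f\|_{W^{k,1}}$ for all $f\in W^{k,1}(\mathbb{R}^n)$. *)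

theory Defs
  imports "HOL-Analysis.Analysis"
begin

text \<open>
  Functions on \<open>\<real>\<^sup>n = real ^ 'n\<close> take values in a type of sort \<open>{real_normed_field, euclidean_space}\<close>,
  that is, in the real or in the complex field. Elements of \<open>L\<^sup>1\<close> and of Sobolev spaces are
  represented by functions, not by classes modulo null sets.
\<close>

subsection \<open>Classical derivatives and test functions\<close>

definition partial_deriv ::
  "'n::finite \<Rightarrow> (real ^ 'n \<Rightarrow> 'b::real_normed_vector) \<Rightarrow> real ^ 'n \<Rightarrow> 'b" where
  "partial_deriv i f x = vector_derivative (\<lambda>t. f (x + t *\<^sub>R axis i 1)) (at 0)"

text \<open>
  The index type carries no order, so an enumeration of the coordinates is fixed once and for all.
  For smooth functions the resulting mixed derivatives do not depend on it.
\<close>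

definition coord_enum :: "'n::finite list" where
  "coord_enum = (SOME is. distinct is \<and> set is = UNIV)"

lemma coord_enum: "distinct (coord_enum :: 'n::finite list)" "set (coord_enum :: 'n list) = UNIV"
proof -
  have "\<exists>is :: 'n list. distinct is \<and> set is = UNIV"
    using finite_distinct_list[of "UNIV :: 'n set"] by auto
  from someI_ex[OF this] show "distinct (coord_enum :: 'n list)" "set (coord_enum :: 'n list) = UNIV"
    unfolding coord_enum_def by auto
qed

definition multi_deriv ::
  "('n::finite \<Rightarrow> nat) \<Rightarrow> (real ^ 'n \<Rightarrow> 'b::real_normed_vector) \<Rightarrow> real ^ 'n \<Rightarrow> 'b" where
  "multi_deriv \<alpha> f = foldr (\<lambda>i. partial_deriv i ^^ \<alpha> i) coord_enum f"

definition multi_order :: "('n::finite \<Rightarrow> nat) \<Rightarrow> nat" where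
  "multi_order \<alpha> = (\<Sum>i\<in>UNIV. \<alpha> i)"

lemma finite_multi_order_le: "finite {\<alpha> :: 'n::finite \<Rightarrow> nat. multi_order \<alpha> \<le> k}"
proof (rule finite_subset)
  show "{\<alpha> :: 'n \<Rightarrow> nat. multi_order \<alpha> \<le> k} \<subseteq> Pi\<^sub>E UNIV (\<lambda>_. {..k})"
  proof
    fix \<alpha> :: "'n \<Rightarrow> nat" assume "\<alpha> \<in> {\<alpha>. multi_order \<alpha> \<le> k}"
    then have "\<alpha> i \<le> k" for i
      using member_le_sum[of i UNIV \<alpha>] by (auto simp: multi_order_def)
    then show "\<alpha> \<in> Pi\<^sub>E UNIV (\<lambda>_. {..k})" by auto
  qed
qed (auto intro: finite_PiE)

text \<open>
  All iterated partial derivatives are Frechet differentiable, hence also continuous; this is the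
  class \<open>C\<^sup>\<infinity>\<close>.
\<close>

definition smooth :: "(real ^ 'n::finite \<Rightarrow> 'b::real_normed_vector) \<Rightarrow> bool" where
  "smooth f \<longleftrightarrow> (\<forall>is. foldr partial_deriv is f differentiable_on UNIV)"

definition test_function :: "(real ^ 'n::finite \<Rightarrow> 'b::real_normed_vector) \<Rightarrow> bool" where
  "test_function \<phi> \<longleftrightarrow> smooth \<phi> \<and> compact (closure {x. \<phi> x \<noteq> 0})"

subsection \<open>Weak derivatives and the Sobolev spaces \<open>W\<^sup>k\<^sup>,\<^sup>1\<close>\<close>

definition locally_integrable :: "(real ^ 'n::finite \<Rightarrow> 'b::euclidean_space) \<Rightarrow> bool" where
  "locally_integrable f \<longleftrightarrow> (\<forall>K. compact K \<longrightarrow> f absolutely_integrable_on K)"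

definition has_weak_deriv ::
  "('n::finite \<Rightarrow> nat) \<Rightarrow> (real ^ 'n \<Rightarrow> 'b::{real_normed_field, euclidean_space}) \<Rightarrow>
    (real ^ 'n \<Rightarrow> 'b) \<Rightarrow> bool" where
  "has_weak_deriv \<alpha> f g \<longleftrightarrow> locally_integrable f \<and> locally_integrable g \<and>
    (\<forall>\<phi> :: real ^ 'n \<Rightarrow> 'b. test_function \<phi> \<longrightarrow>
      (LINT x|lebesgue. f x * multi_deriv \<alpha> \<phi> x) =
        (- 1) ^ multi_order \<alpha> * (LINT x|lebesgue. g x * \<phi> x))"

text \<open>A representative of \<open>D\<^sup>\<alpha> f\<close>, which is determined only up to a null set.\<close>

definition weak_deriv ::
  "('n::finite \<Rightarrow> nat) \<Rightarrow> (real ^ 'n \<Rightarrow> 'b::{real_normed_field, euclidean_space}) \<Rightarrow>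
    real ^ 'n \<Rightarrow> 'b" where
  "weak_deriv \<alpha> f = (SOME g. has_weak_deriv \<alpha> f g)"

definition sobolev ::
  "nat \<Rightarrow> (real ^ 'n::finite \<Rightarrow> 'b::{real_normed_field, euclidean_space}) set" where
  "sobolev k = {f. integrable lebesgue f \<and>
    (\<forall>\<alpha>. multi_order \<alpha> \<le> k \<longrightarrow> (\<exists>g. has_weak_deriv \<alpha> f g \<and> integrable lebesgue g))}"

definition sobolev_norm ::
  "nat \<Rightarrow> (real ^ 'n::finite \<Rightarrow> 'b::{real_normed_field, euclidean_space}) \<Rightarrow> real" where
  "sobolev_norm k f =
    (\<Sum>\<alpha> | multi_order \<alpha> \<le> k. LINT x|lebesgue. norm (weak_deriv \<alpha> f x))"

subsection \<open>The Hausdorff operator\<close>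

definition hausdorff_op ::
  "(real ^ 'n::finite \<Rightarrow> real) \<Rightarrow> (real ^ 'n \<Rightarrow> 'b::euclidean_space) \<Rightarrow> real ^ 'n \<Rightarrow> 'b" where
  "hausdorff_op \<Phi> f x = (LINT y|lebesgue. \<Phi> y *\<^sub>R f (x /\<^sub>R norm y))"

text \<open>The type argument selects the scalar field.\<close>

definition hausdorff_bounded_on_sobolev ::
  "'b::{real_normed_field, euclidean_space} itself \<Rightarrow> nat \<Rightarrow> (real ^ 'n::finite \<Rightarrow> real) \<Rightarrow> bool" where
  "hausdorff_bounded_on_sobolev _ k \<Phi> \<longleftrightarrow>
    (\<forall>f \<in> sobolev k :: (real ^ 'n \<Rightarrow> 'b) set.
      AE x in lebesgue. integrable lebesgue (\<lambda>y. \<Phi> y *\<^sub>R f (x /\<^sub>R norm y))) \<and>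
    (\<exists>C. \<forall>f \<in> sobolev k :: (real ^ 'n \<Rightarrow> 'b) set.
      hausdorff_op \<Phi> f \<in> sobolev k \<and>
      sobolev_norm k (hausdorff_op \<Phi> f) \<le> C * sobolev_norm k f)"

end

theory Submission
  imports Defs "HOL-Computational_Algebra.Polynomial"
begin

text \<open>
  Sufficiency: moving the dilation by \<open>norm y\<close> from \<open>f\<close> onto the test function produces the factor
  \<open>1 / norm y ^ multi_order \<alpha>\<close>, and Fubini gives the formula for the weak derivatives together with
  the \<open>L\<^sup>1\<close> bounds.

  Necessity: a nonnegative bump function \<open>f\<close> shows that \<open>norm y ^ n * \<Phi> y\<close> is integrable. For the
  weight \<open>norm y ^ n / norm y ^ k\<close> take \<open>f\<close> smooth with compact support such that its \<open>k\<close>-th derivative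
  in one coordinate direction is nonnegative, and not identically zero, on the half-space where that
  coordinate is positive. The half-space is invariant under dilations, so nothing cancels when the
  weak derivative of \<open>hausdorff_op \<Phi> f\<close> is tested against functions increasing to its indicator.
\<close>

subsection \<open>Smooth functions of one variable\<close>

text \<open>For k >= 1 a k-th derivative of a compactly supported smooth function has integral zero,
  so it changes sign and the positivity argument for order 0 breaks down: negative values coming
  from one dilate could cancel positive values coming from another. Keeping the negative values on
  one side of a hyperplane through the origin prevents this, since x / |y| stays on the side of x.
  The formula for the weak derivative cannot be used for necessity, because integrability of its
  weight is the claim. Instead each single dilate is integrated by parts, under the weight |y|^n
  that is already under control, and the resulting nonnegative integrals are bounded by the L1 norm
  of the given weak derivative, uniformly in the test function. The functions built here are
  products of one-variable functions, each carried along with the whole sequence of its derivatives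
  (\<open>F m\<close> is the m-th derivative of \<open>F 0\<close>), so that mixed partial
  derivatives of every order are explicit.\<close>

definition deriv_chain :: "(nat \<Rightarrow> real \<Rightarrow> real) \<Rightarrow> bool" where
  "deriv_chain F \<longleftrightarrow> (\<forall>m x. (F m has_real_derivative F (Suc m) x) (at x))"

lemma deriv_chainD: "deriv_chain F \<Longrightarrow> (F m has_real_derivative F (Suc m) x) (at x)"
  by (simp add: deriv_chain_def)

lemma deriv_chain_isCont: "deriv_chain F \<Longrightarrow> isCont (F m) x"
  using DERIV_isCont deriv_chainD by blast

lemma deriv_chain_affine:
  assumes "deriv_chain F"
  shows "deriv_chain (\<lambda>m x. c ^ m * F m (c * x + d))"
  unfolding deriv_chain_def
proof (intro allI)
  fix m x
  have "((\<lambda>x. F m (c * x + d)) has_real_derivative F (Suc m) (c * x + d) * c) (at x)"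
    by (rule DERIV_chain2[OF deriv_chainD[OF assms]]) (auto intro!: derivative_eq_intros)
  from DERIV_cmult[OF this, of "c ^ m"]
  show "((\<lambda>x. c ^ m * F m (c * x + d)) has_real_derivative c ^ Suc m * F (Suc m) (c * x + d)) (at x)"
    by (simp add: mult_ac)
qed

text \<open>The Leibniz rule for all orders at once; the step from m to m + 1 is Pascal's
  rule.\<close>

lemma deriv_chain_mult:
  assumes F: "deriv_chain F" and G: "deriv_chain G"
  shows "deriv_chain (\<lambda>m x. \<Sum>k\<le>m. of_nat (m choose k) * (F k x * G (m - k) x))"
  unfolding deriv_chain_def
proof (intro allI)
  fix m x
  let ?T = "\<lambda>k. F k x * G (Suc m - k) x"
  have "((\<lambda>x. \<Sum>k\<le>m. of_nat (m choose k) * (F k x * G (m - k) x)) has_real_derivative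
      (\<Sum>k\<le>m. of_nat (m choose k) * (F (Suc k) x * G (m - k) x + G (Suc (m - k)) x * F k x))) (at x)"
    by (intro DERIV_sum DERIV_cmult DERIV_mult deriv_chainD F G)
  also have "(\<Sum>k\<le>m. of_nat (m choose k) * (F (Suc k) x * G (m - k) x + G (Suc (m - k)) x * F k x))
      = (\<Sum>k\<le>m. of_nat (m choose k) * ?T (Suc k)) + (\<Sum>k\<le>m. of_nat (m choose k) * ?T k)"
    unfolding sum.distrib[symmetric] by (intro sum.cong) (auto simp: algebra_simps Suc_diff_le)
  also have "(\<Sum>k\<le>m. of_nat (m choose k) * ?T k) = ?T 0 + (\<Sum>k\<le>m. of_nat (m choose Suc k) * ?T (Suc k))"
  proof -
    \<comment> \<open>The added summand is 0 because \<open>m choose Suc m\<close> is 0; shifting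
      the index afterwards lines up both sums for Pascal's rule.\<close>
    have "(\<Sum>k\<le>m. of_nat (m choose k) * ?T k) = (\<Sum>k\<le>Suc m. of_nat (m choose k) * ?T k)"
      by (simp add: binomial_eq_0)
    also have "\<dots> = ?T 0 + (\<Sum>k\<le>m. of_nat (m choose Suc k) * ?T (Suc k))"
      by (subst sum.atMost_Suc_shift) simp
    finally show ?thesis .
  qed
  also have "(\<Sum>k\<le>m. of_nat (m choose k) * ?T (Suc k)) + (?T 0 + (\<Sum>k\<le>m. of_nat (m choose Suc k) * ?T (Suc k)))
     = (\<Sum>k\<le>Suc m. of_nat (Suc m choose k) * ?T k)"
    unfolding sum.atMost_Suc_shift[of "\<lambda>k. of_nat (Suc m choose k) * ?T k" m]
    by (simp add: sum.distrib[symmetric] algebra_simps)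
  finally show "((\<lambda>x. \<Sum>k\<le>m. of_nat (m choose k) * (F k x * G (m - k) x)) has_real_derivative
     (\<Sum>k\<le>Suc m. of_nat (Suc m choose k) * (F k x * G (Suc m - k) x))) (at x)" .
qed

text \<open>The complement of \<open>S\<close> is open, so vanishing there passes to the derivative,
  and induction reaches every order.\<close>

lemma deriv_chain_support:
  assumes F: "deriv_chain F" and S: "closed S" and 0: "\<And>t. t \<notin> S \<Longrightarrow> F 0 t = 0" and t: "t \<notin> S"
  shows "F m t = 0"
  using t
proof (induction m arbitrary: t)
  case (Suc m)
  have "(F m has_real_derivative 0) (at t)"
    by (rule has_field_derivative_transform_within_open[where S="- S" and f="\<lambda>_. 0"])
       (use Suc S in auto)
  then show ?case using DERIV_unique deriv_chainD[OF F] by blast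
qed (simp add: 0)

text \<open>With s = 1/x this is the flatness at 0 of a polynomial in 1/x times exp(-c/x).\<close>

lemma poly_mult_exp_tendsto_0:
  assumes "(c::real) > 0"
  shows "((\<lambda>s. poly p s * exp (- c * s)) \<longlongrightarrow> 0) at_top"
proof -
  have *: "((\<lambda>s. s ^ i * exp (- c * s)) \<longlongrightarrow> 0) at_top" for i :: nat
  proof -
    have "((\<lambda>s. (c * s) ^ i / exp (c * s)) \<longlongrightarrow> 0) at_top"
      by (rule filterlim_compose[OF tendsto_power_div_exp_0])
         (use assms in \<open>simp add: filterlim_tendsto_pos_mult_at_top[OF tendsto_const] filterlim_ident\<close>)
    from tendsto_mult_right[OF this, of "1 / c ^ i"] show ?thesis
      using assms by (simp add: power_mult_distrib exp_minus field_simps)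
  qed
  have "((\<lambda>s. \<Sum>i\<le>degree p. coeff p i * (s ^ i * exp (- c * s))) \<longlongrightarrow> (\<Sum>i\<le>degree p. coeff p i * 0)) at_top"
    by (intro tendsto_intros *)
  then show ?thesis by (simp add: poly_altdef sum_distrib_right sum_distrib_left mult_ac)
qed

text \<open>The polynomial is a parameter because this family, unlike exp(-c/x) alone, is closed
  under differentiation.\<close>

definition flat_fun :: "real \<Rightarrow> real poly \<Rightarrow> real \<Rightarrow> real" where
  "flat_fun c p x = (if x > 0 then poly p (1 / x) * exp (- c * (1 / x)) else 0)"

text \<open>With s = 1/x one has s' = -s^2, which turns p(s) exp(-c s) into s^2 (c p(s) - p'(s))
  exp(-c s). Only x = 0 needs more than the chain rule.\<close>

lemma flat_fun_deriv:
  assumes "c > 0"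
  shows "(flat_fun c p has_real_derivative flat_fun c ([:0, 0, 1:] * (smult c p - pderiv p)) x) (at x)"
proof -
  let ?q = "[:0, 0, 1:] * (smult c p - pderiv p)"
  consider "x > 0" | "x < 0" | "x = 0" by linarith
  then show ?thesis
  proof cases
    case 1
    have inv: "((\<lambda>x. 1 / x) has_real_derivative - (1 / x)\<^sup>2) (at x)"
      using DERIV_inverse[of x] 1 by (simp add: inverse_eq_divide power2_eq_square)
    have "((\<lambda>x. poly p (1 / x)) has_real_derivative poly (pderiv p) (1 / x) * - (1 / x)\<^sup>2) (at x)"
      by (rule DERIV_chain2[OF poly_DERIV inv])
    moreover have "((\<lambda>x. exp (- c * (1 / x))) has_real_derivative
        exp (- c * (1 / x)) * (- c * - (1 / x)\<^sup>2)) (at x)"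
      by (rule DERIV_chain2[OF DERIV_exp DERIV_cmult[OF inv]])
    ultimately have "((\<lambda>x. poly p (1 / x) * exp (- c * (1 / x))) has_real_derivative
        poly (pderiv p) (1 / x) * - (1 / x)\<^sup>2 * exp (- c * (1 / x)) +
        exp (- c * (1 / x)) * (- c * - (1 / x)\<^sup>2) * poly p (1 / x)) (at x)"
      by (rule DERIV_mult)
    also have "poly (pderiv p) (1 / x) * - (1 / x)\<^sup>2 * exp (- c * (1 / x)) +
        exp (- c * (1 / x)) * (- c * - (1 / x)\<^sup>2) * poly p (1 / x) = flat_fun c ?q x"
      using 1 by (simp add: flat_fun_def power2_eq_square algebra_simps)
    finally have "((\<lambda>x. poly p (1 / x) * exp (- c * (1 / x))) has_real_derivative flat_fun c ?q x) (at x)" .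
    then show ?thesis
      by (rule has_field_derivative_transform_within_open[where S="{0<..}"])
         (use 1 in \<open>auto simp: flat_fun_def\<close>)
  next
    case 2
    show ?thesis
      by (rule has_field_derivative_transform_within_open[where S="{..<0}" and f="\<lambda>_. 0"])
         (use 2 in \<open>auto simp: flat_fun_def\<close>)
  next
    case 3
    have "((\<lambda>h. flat_fun c p h / h) \<longlongrightarrow> 0) (at_left 0)"
      by (rule tendsto_eventually)
         (auto simp: flat_fun_def eventually_at_filter)
    moreover have "((\<lambda>h. flat_fun c p h / h) \<longlongrightarrow> 0) (at_right 0)"
    proof -
      \<comment> \<open>Dividing by h multiplies by s = 1/h, so the difference quotient at 0 is
        again a polynomial in s times the exponential.\<close>
      have "((\<lambda>s. poly (p * [:0, 1:]) s * exp (- c * s)) \<longlongrightarrow> 0) at_top"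
        by (rule poly_mult_exp_tendsto_0[OF assms])
      from filterlim_compose[OF this filterlim_inverse_at_top_right]
      show ?thesis
        by (rule Lim_transform_eventually)
           (auto simp: eventually_at_filter flat_fun_def divide_inverse mult_ac)
    qed
    ultimately have "((\<lambda>h. flat_fun c p h / h) \<longlongrightarrow> 0) (at 0)"
      by (simp add: filterlim_split_at)
    then show ?thesis
      using 3 by (simp add: DERIV_def flat_fun_def)
  qed
qed

text \<open>The parameter \<open>c\<close> regulates steepness: as it tends to 0 the function tends
  to the indicator of the interval, while its support stays the same.\<close>

definition bump :: "real \<Rightarrow> real \<Rightarrow> real \<Rightarrow> real \<Rightarrow> real" where
  "bump c a b t = (if a < t \<and> t < b then exp (- c / (t - a)) * exp (- c / (b - t)) else 0)"

lemma bump_deriv_chain: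
  assumes "c > 0"
  shows "\<exists>F. deriv_chain F \<and> F 0 = bump c a b"
proof -
  define q where "q = (\<lambda>p. [:0, 0, 1:] * (smult c p - pderiv p))"
  define H where "H = (\<lambda>m. flat_fun c ((q ^^ m) 1))"
  have H: "deriv_chain H"
    using flat_fun_deriv[OF assms] by (auto simp: deriv_chain_def H_def q_def)
  \<comment> \<open>The bump is the product of the flat function exp(-c/x) evaluated at t - a and at
    b - t.\<close>
  note B = deriv_chain_mult[OF deriv_chain_affine[OF H, of 1 "- a"] deriv_chain_affine[OF H, of "- 1" b]]
  then show ?thesis
    by (intro exI conjI) (assumption, auto simp: H_def flat_fun_def bump_def fun_eq_iff)
qed

lemma bump_nonneg: "bump c a b t \<ge> 0"
  by (simp add: bump_def)

lemma bump_pos: "a < t \<Longrightarrow> t < b \<Longrightarrow> bump c a b t > 0"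
  by (simp add: bump_def)

lemma bump_le_1: "c > 0 \<Longrightarrow> bump c a b t \<le> 1"
  unfolding bump_def by (auto intro!: mult_le_one)

lemma bump_tendsto_indicator:
  "(\<lambda>m. bump (1 / real (Suc m)) a b t) \<longlonglongrightarrow> indicator {a<..<b} t"
proof (cases "a < t \<and> t < b")
  case True
  have "(\<lambda>m. exp (- (1 / real (Suc m)) / (t - a)) * exp (- (1 / real (Suc m)) / (b - t)))
      \<longlonglongrightarrow> exp (- 0 / (t - a)) * exp (- 0 / (b - t))"
    using True LIMSEQ_inverse_real_of_nat by (intro tendsto_intros) (auto simp: inverse_eq_divide)
  then show ?thesis using True by (simp add: bump_def)
qed (auto simp: bump_def)

text \<open>
  If \<open>U\<close> is an antiderivative of \<open>u\<close>, then \<open>U t - U (t + L)\<close> again has compact support for large \<open>L\<close>,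
  and its derivative \<open>u t - u (t + L)\<close> agrees with \<open>u\<close> on the positive half-line.
\<close>

lemma deriv_chain_one_signed:
  "\<exists>F R. deriv_chain F \<and> (\<forall>t. \<bar>t\<bar> > R \<longrightarrow> F 0 t = 0) \<and> (\<forall>t>0. F k t \<ge> 0) \<and>
     (\<forall>t. 0 < t \<and> t < 1 \<longrightarrow> F k t > 0)"
proof (induction k)
  case 0
  obtain F where "deriv_chain F" "F 0 = bump 1 0 1"
    using bump_deriv_chain[of 1] by fastforce
  then show ?case
    by (intro exI[of _ F] exI[of _ 1]) (auto simp: bump_def)
next
  case (Suc k)
  then obtain F R where F: "deriv_chain F" and supp: "\<And>t. \<bar>t\<bar> > R \<Longrightarrow> F 0 t = 0"
    and nn: "\<And>t. t > 0 \<Longrightarrow> F k t \<ge> 0" and pos: "\<And>t. 0 < t \<Longrightarrow> t < 1 \<Longrightarrow> F k t > 0" by blast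
  obtain U where "\<forall>x. -\<infinity> < ereal x \<longrightarrow> ereal x < \<infinity> \<longrightarrow> (U has_vector_derivative F 0 x) (at x)"
    using einterval_antiderivative[of "-\<infinity>" \<infinity> "F 0"] deriv_chain_isCont[OF F] by auto
  then have U: "(U has_real_derivative F 0 x) (at x)" for x
    by (simp add: has_real_derivative_iff_has_vector_derivative)
  \<comment> \<open>\<open>L\<close> exceeds |R|, so for t > 0 the point t + L has left the support
    [-R, R].\<close>
  define L where "L = \<bar>R\<bar> + 1"
  define G where "G = (\<lambda>m t. case m of 0 \<Rightarrow> U t - U (t + L) | Suc m \<Rightarrow> F m t - F m (t + L))"
  have G: "deriv_chain G"
    unfolding deriv_chain_def
  proof (intro allI)
    fix m x
    show "(G m has_real_derivative G (Suc m) x) (at x)"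
    proof (cases m)
      case 0
      then show ?thesis by (auto simp: G_def intro!: DERIV_diff U DERIV_shift[THEN iffD1])
    next
      case (Suc m')
      then show ?thesis
        by (auto simp: G_def intro!: DERIV_diff deriv_chainD[OF F] DERIV_shift[THEN iffD1])
    qed
  qed
  have const: "U t = U (t + L)" if far: "\<And>s. t < s \<Longrightarrow> s < t + L \<Longrightarrow> \<bar>s\<bar> > R" for t
  proof (rule DERIV_isconst_end[of t "t + L" U, symmetric])
    show "t < t + L" by (simp add: L_def)
    show "continuous_on {t..t + L} U"
      using U[THEN DERIV_isCont] by (auto intro: continuous_at_imp_continuous_on)
    fix s assume "t < s" "s < t + L"
    then show "(U has_real_derivative 0) (at s)"
      using U[of s] supp[OF far] by simp
  qed
  \<comment> \<open>Far to the right the whole interval (t, t + L) lies beyond R; far to the left it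
    ends before -|R|. Either way \<open>U\<close> is constant on it.\<close>
  have "G 0 t = 0" if "\<bar>t\<bar> > \<bar>R\<bar> + L" for t
    using that unfolding G_def L_def nat.case
    by (intro right_minus_eq[THEN iffD2] const[unfolded L_def]) linarith
  moreover have shift0: "F k (t + L) = 0" if "t > 0" for t
    by (rule deriv_chain_support[OF F, of "{-R..R}"]) (use that supp in \<open>auto simp: L_def\<close>)
  ultimately show ?case
    using G nn pos by (intro exI[of _ G] exI[of _ "\<bar>R\<bar> + L"]) (auto simp: G_def)
qed

subsection \<open>Test functions\<close>

lemma partial_deriv_eqI:
  "((\<lambda>t. f (x + t *\<^sub>R axis i 1)) has_vector_derivative D) (at 0) \<Longrightarrow> partial_deriv i f x = D"
  unfolding partial_deriv_def by (rule vector_derivative_at)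

lemma has_vector_derivative_along_axis:
  assumes "f differentiable (at (x + s *\<^sub>R axis i 1))"
  shows "((\<lambda>t. f (x + t *\<^sub>R axis i 1)) has_vector_derivative partial_deriv i f (x + s *\<^sub>R axis i 1)) (at s)"
proof -
  obtain f' where f': "(f has_derivative f') (at (x + s *\<^sub>R axis i 1))"
    using assms by (auto simp: differentiable_def)
  interpret bounded_linear f' by (rule has_derivative_bounded_linear[OF f'])
  \<comment> \<open>Base point and parameter are kept free because two pairs are used: parameter 0
    at the shifted base point identifies \<open>partial_deriv\<close>, and parameter
    \<open>s\<close> at \<open>x\<close> gives the claim.\<close>
  have *: "((\<lambda>t. f (y + t *\<^sub>R axis i 1)) has_vector_derivative f' (axis i 1)) (at u)"
    if "y + u *\<^sub>R axis i 1 = x + s *\<^sub>R axis i 1" for y u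
  proof -
    have "((\<lambda>t. y + t *\<^sub>R axis i 1) has_derivative (\<lambda>h. h *\<^sub>R axis i 1)) (at u)"
      by (auto intro!: derivative_eq_intros)
    from has_derivative_compose[OF this, of f f'] f' that show ?thesis
      by (simp add: has_vector_derivative_def scaleR)
  qed
  from partial_deriv_eqI[OF *[of "x + s *\<^sub>R axis i 1" 0]] *[of x s] show ?thesis by simp
qed

lemma smooth_differentiable: "smooth f \<Longrightarrow> f differentiable (at x)"
  unfolding smooth_def by (drule spec[of _ "[]"]) (auto simp: differentiable_on_def)

lemma smooth_foldr_partial_deriv: "smooth f \<Longrightarrow> smooth (foldr partial_deriv is f)"
  unfolding smooth_def by (metis foldr_append)

lemma smooth_partial_deriv: "smooth f \<Longrightarrow> smooth (partial_deriv i f)"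
  using smooth_foldr_partial_deriv[of f "[i]"] by simp

lemma smooth_continuous: "smooth f \<Longrightarrow> continuous_on S f"
  by (meson smooth_differentiable differentiable_imp_continuous_within continuous_at_imp_continuous_on)

lemma test_function_iff: "test_function \<phi> \<longleftrightarrow> smooth \<phi> \<and> (\<exists>R. \<forall>x. norm x > R \<longrightarrow> \<phi> x = 0)"
  unfolding test_function_def compact_closure bounded_iff by (auto simp: not_le[symmetric])

lemma partial_deriv_eq_0:
  assumes "\<And>x. norm x > R \<Longrightarrow> f x = 0" "norm x > R"
  shows "partial_deriv i f x = 0"
proof (rule partial_deriv_eqI)
  let ?S = "(\<lambda>t::real. x + t *\<^sub>R axis i 1) -` {y. norm y > R}"
  have "open ?S"
    unfolding vimage_Collect_eq by (intro open_Collect_less continuous_intros)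
  then show "((\<lambda>t. f (x + t *\<^sub>R axis i 1)) has_vector_derivative 0) (at 0)"
    unfolding has_vector_derivative_def
    by (rule has_derivative_transform_within_open[where f="\<lambda>_. 0", rotated])
       (use assms in auto)
qed

lemma test_function_partial_deriv: "test_function \<phi> \<Longrightarrow> test_function (partial_deriv i \<phi>)"
  unfolding test_function_iff using smooth_partial_deriv partial_deriv_eq_0 by blast

lemma test_function_foldr_partial_deriv:
  "test_function \<phi> \<Longrightarrow> test_function (foldr partial_deriv is \<phi>)"
  by (induction "is") (auto intro: test_function_partial_deriv)

text \<open>Flattening the multi-index into one list of directions replaces nested inductions over
  coordinates and powers by a single list induction.\<close>

definition multi_list :: "('n::finite \<Rightarrow> nat) \<Rightarrow> 'n list" where
  "multi_list \<alpha> = concat (map (\<lambda>i. replicate (\<alpha> i) i) coord_enum)"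

lemma multi_deriv_eq_foldr:
  fixes f :: "real ^ 'n::finite \<Rightarrow> 'b::real_normed_vector"
  shows "multi_deriv \<alpha> f = foldr partial_deriv (multi_list \<alpha>) f"
proof -
  have rep: "foldr partial_deriv (replicate n i) g = (partial_deriv i ^^ n) g"
    for n i and g :: "real ^ 'n \<Rightarrow> 'b"
    by (induction n) auto
  have "foldr (\<lambda>i. partial_deriv i ^^ \<alpha> i) js f =
      foldr partial_deriv (concat (map (\<lambda>i. replicate (\<alpha> i) i) js)) f" for js
    by (induction js) (auto simp: rep)
  then show ?thesis unfolding multi_deriv_def multi_list_def .
qed

lemma length_multi_list: "length (multi_list \<alpha>) = multi_order \<alpha>"
  using sum.distinct_set_conv_list[OF coord_enum(1), of \<alpha>]
  by (simp add: multi_list_def multi_order_def length_concat coord_enum comp_def)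

lemma count_multi_list:
  fixes \<alpha> :: "'n::finite \<Rightarrow> nat"
  shows "count_list (multi_list \<alpha>) i = \<alpha> i"
proof -
  have rep: "count_list (replicate n j) i = (if j = i then n else 0)" for n and j :: 'n
    by (induction n) auto
  have "count_list (concat (map (\<lambda>i. replicate (\<alpha> i) i) js)) i = (if i \<in> set js then \<alpha> i else 0)"
    if "distinct js" for js
    using that by (induction js) (auto simp: rep)
  then show ?thesis using coord_enum[where 'n='n] by (simp add: multi_list_def)
qed

subsection \<open>Tensor products of functions of one variable\<close>

text \<open>Real-valued on purpose: scaling by a vector \<open>v\<close> of the target type serves
  the real and the complex field alike. A partial derivative acts on one factor only.\<close>

definition tensor :: "('n::finite \<Rightarrow> real \<Rightarrow> real) \<Rightarrow> real ^ 'n \<Rightarrow> real" where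
  "tensor g x = (\<Prod>i\<in>UNIV. g i (x $ i))"

text \<open>\<open>e\<close> records how many derivatives have been taken in each coordinate, so the
  result has the form of the input and the rule can be iterated.\<close>

lemma partial_deriv_tensor:
  fixes v :: "'b::real_normed_vector" and F :: "'n::finite \<Rightarrow> nat \<Rightarrow> real \<Rightarrow> real"
  assumes F: "\<And>i. deriv_chain (F i)"
  shows "partial_deriv j (\<lambda>x. tensor (\<lambda>i. F i (e i)) x *\<^sub>R v) =
    (\<lambda>x. tensor (\<lambda>i. F i ((e(j := Suc (e j))) i)) x *\<^sub>R v)"
proof (intro ext partial_deriv_eqI)
  fix x :: "real ^ 'n"
  let ?c = "\<Prod>i\<in>UNIV - {j}. F i (e i) (x $ i)"
  have eq: "tensor g y = g j (y $ j) * (\<Prod>i\<in>UNIV - {j}. g i (y $ i))" for g y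
    unfolding tensor_def by (rule prod.remove) auto
  have "((\<lambda>t. F j (e j) (x $ j + t)) has_real_derivative F j (Suc (e j)) (x $ j)) (at 0)"
    using deriv_chainD[OF F, of j "e j" "x $ j"]
      DERIV_shift[of "F j (e j)" "F j (Suc (e j)) (x $ j)" 0 "x $ j"] by (simp add: add.commute)
  from DERIV_cmult_right[OF this, of ?c]
  have "((\<lambda>t. F j (e j) (x $ j + t) * ?c) has_real_derivative F j (Suc (e j)) (x $ j) * ?c) (at 0)" .
  moreover have "(\<lambda>t. tensor (\<lambda>i. F i (e i)) (x + t *\<^sub>R axis j 1)) = (\<lambda>t. F j (e j) (x $ j + t) * ?c)"
    unfolding eq by (auto simp: axis_def intro!: prod.cong)
  moreover have "tensor (\<lambda>i. F i ((e(j := Suc (e j))) i)) x = F j (Suc (e j)) (x $ j) * ?c"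
    unfolding eq by (auto intro!: prod.cong)
  ultimately show "((\<lambda>t. tensor (\<lambda>i. F i (e i)) (x + t *\<^sub>R axis j 1) *\<^sub>R v) has_vector_derivative
      tensor (\<lambda>i. F i ((e(j := Suc (e j))) i)) x *\<^sub>R v) (at 0)"
    by (auto simp: has_real_derivative_iff_has_vector_derivative
        intro!: has_vector_derivative_scaleR[where g="\<lambda>_. v" and g'=0, simplified])
qed

lemma foldr_partial_deriv_tensor:
  fixes v :: "'b::real_normed_vector"
  assumes F: "\<And>i. deriv_chain (F i)"
  shows "foldr partial_deriv js (\<lambda>x. tensor (\<lambda>i. F i (e i)) x *\<^sub>R v) =
    (\<lambda>x. tensor (\<lambda>i. F i (e i + count_list js i)) x *\<^sub>R v)"
proof (induction js)
  case (Cons j js)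
  have "partial_deriv j (\<lambda>x. tensor (\<lambda>i. F i (e i + count_list js i)) x *\<^sub>R v) =
      (\<lambda>x. tensor (\<lambda>i. F i (((\<lambda>i. e i + count_list js i)(j := Suc (e j + count_list js j))) i)) x *\<^sub>R v)"
    by (rule partial_deriv_tensor[OF F])
  also have "((\<lambda>i. e i + count_list js i)(j := Suc (e j + count_list js j))) =
      (\<lambda>i. e i + count_list (j # js) i)"
    by auto
  finally show ?case using Cons by simp
qed simp

lemma multi_deriv_tensor:
  fixes v :: "'b::real_normed_vector"
  assumes F: "\<And>i. deriv_chain (F i)"
  shows "multi_deriv \<alpha> (\<lambda>x. tensor (\<lambda>i. F i (e i)) x *\<^sub>R v) =
    (\<lambda>x. tensor (\<lambda>i. F i (e i + \<alpha> i)) x *\<^sub>R v)"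
  unfolding multi_deriv_eq_foldr foldr_partial_deriv_tensor[OF F] count_multi_list ..

lemma tensor_differentiable:
  assumes "\<And>i. deriv_chain (F i)"
  shows "tensor (\<lambda>i. F i (e i)) differentiable (at x)"
proof -
  have "(\<lambda>x. F i (e i) (x $ i)) differentiable (at x)" for i
    by (rule differentiable_compose[of "F i (e i)"])
       (use deriv_chainD[OF assms, of i "e i"] in
         \<open>auto simp: real_differentiable_def intro: bounded_linear_imp_differentiable bounded_linear_vec_nth\<close>)
  then have "\<forall>i. \<exists>D. ((\<lambda>x. F i (e i) (x $ i)) has_derivative D) (at x)"
    by (simp add: differentiable_def)
  then obtain D where "\<And>i. ((\<lambda>x. F i (e i) (x $ i)) has_derivative D i) (at x)" by metis
  from has_derivative_prod[of UNIV "\<lambda>i x. F i (e i) (x $ i)", OF this] show ?thesis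
    unfolding differentiable_def tensor_def[abs_def] by blast
qed

lemma smooth_tensor:
  fixes v :: "'b::real_normed_vector"
  assumes F: "\<And>i. deriv_chain (F i)"
  shows "smooth (\<lambda>x. tensor (\<lambda>i. F i (e i)) x *\<^sub>R v)"
proof -
  have "(\<lambda>x. tensor (\<lambda>i. F i (e i)) x *\<^sub>R v) differentiable (at x)" for e x
    by (rule differentiable_scaleR[OF tensor_differentiable[of F e, OF F] differentiable_const])
  then show ?thesis
    unfolding smooth_def foldr_partial_deriv_tensor[OF F]
    by (simp add: differentiable_on_def)
qed

lemma tensor_eq_0:
  assumes "\<And>i t. t \<notin> cbox (a $ i) (b $ i) \<Longrightarrow> g i t = 0" "x \<notin> cbox a b"
  shows "tensor g x = 0"
  using assms unfolding tensor_def by (auto simp: mem_box_cart)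

lemma test_function_tensor:
  fixes v :: "'b::real_normed_vector"
  assumes F: "\<And>i. deriv_chain (F i)"
    and supp: "\<And>i t. t \<notin> cbox (a $ i) (b $ i) \<Longrightarrow> F i 0 t = 0"
  shows "test_function (\<lambda>x. tensor (\<lambda>i. F i 0) x *\<^sub>R v)"
proof -
  obtain R where "\<And>x. x \<in> cbox a b \<Longrightarrow> norm x \<le> R"
    using bounded_cbox[of a b] by (auto simp: bounded_iff)
  then have "norm x > R \<Longrightarrow> tensor (\<lambda>i. F i 0) x *\<^sub>R v = 0" for x
    using tensor_eq_0[of a b "\<lambda>i. F i 0" x] supp by force
  then show ?thesis
    unfolding test_function_iff using smooth_tensor[of F "\<lambda>_. 0" v, OF F] by blast
qed

lemma bump_tensor_test_function:
  fixes v :: "'b::real_normed_vector"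
  assumes "c > 0"
  shows "test_function (\<lambda>x. tensor (\<lambda>i. bump c (a $ i) (b $ i)) x *\<^sub>R v)"
proof -
  have "\<forall>i. \<exists>F. deriv_chain F \<and> F 0 = bump c (a $ i) (b $ i)"
    using bump_deriv_chain[OF assms] by blast
  then obtain F where F: "\<And>i. deriv_chain (F i)" "\<And>i. F i 0 = bump c (a $ i) (b $ i)" by metis
  have "test_function (\<lambda>x. tensor (\<lambda>i. F i 0) x *\<^sub>R v)"
    by (rule test_function_tensor[of F a b, OF F(1)]) (auto simp: F(2) bump_def)
  then show ?thesis by (simp add: F(2))
qed

lemma bump_tensor_bounds:
  assumes "c > 0"
  shows "0 \<le> tensor (\<lambda>i. bump c (a $ i) (b $ i)) x" "tensor (\<lambda>i. bump c (a $ i) (b $ i)) x \<le> 1"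
    "x \<notin> box a b \<Longrightarrow> tensor (\<lambda>i. bump c (a $ i) (b $ i)) x = 0"
  unfolding tensor_def
  by (auto intro!: prod_nonneg prod_le_1 bump_nonneg bump_le_1 assms simp: mem_box_cart)
     (auto simp: bump_def)

lemma bump_tensor_tendsto_indicator:
  "(\<lambda>m. tensor (\<lambda>i. bump (1 / real (Suc m)) (a $ i) (b $ i)) x) \<longlonglongrightarrow> indicator (box a b) x"
proof -
  have "(\<lambda>m. \<Prod>i\<in>UNIV. bump (1 / real (Suc m)) (a $ i) (b $ i) (x $ i))
      \<longlonglongrightarrow> (\<Prod>i\<in>UNIV. indicator {a $ i<..<b $ i} (x $ i))"
    by (intro tendsto_prod bump_tendsto_indicator)
  also have "(\<Prod>i\<in>UNIV. indicator {a $ i<..<b $ i} (x $ i) :: real) = indicator (box a b) x"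
    by (auto simp: indicator_def mem_box_cart)
  finally show ?thesis by (simp add: tensor_def)
qed

subsection \<open>Integration by parts\<close>

lemma integrable_lborel_bounded_support:
  fixes f :: "'a::euclidean_space \<Rightarrow> 'b::{banach, second_countable_topology}"
  assumes "continuous_on UNIV f" "\<And>x. norm x > R \<Longrightarrow> f x = 0"
  shows "integrable lborel f"
proof -
  have "integrable lborel (\<lambda>x. indicator (cball 0 R) x *\<^sub>R f x)"
    by (rule borel_integrable_compact) (use assms in \<open>auto intro: continuous_on_subset\<close>)
  also have "(\<lambda>x. indicator (cball 0 R) x *\<^sub>R f x) = f"
    using assms(2) by (auto simp: indicator_def fun_eq_iff not_le)
  finally show ?thesis .
qed

lemma bounded_of_bounded_support:
  fixes f :: "'a::euclidean_space \<Rightarrow> 'b::real_normed_vector"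
  assumes "continuous_on UNIV f" "\<And>x. norm x > R \<Longrightarrow> f x = 0"
  shows "\<exists>M\<ge>0. \<forall>x. norm (f x) \<le> M"
proof -
  have "bounded (f ` cball 0 R)"
    by (intro compact_imp_bounded compact_continuous_image)
       (use assms in \<open>auto intro: continuous_on_subset\<close>)
  then obtain M where M: "\<And>x. norm x \<le> R \<Longrightarrow> norm (f x) \<le> M" unfolding bounded_iff by fastforce
  have "norm (f x) \<le> \<bar>M\<bar>" for x
    using M[of x] assms(2)[of x] by (cases "norm x \<le> R") auto
  then show ?thesis by (intro exI[of _ "\<bar>M\<bar>"]) auto
qed

text \<open>By translation invariance the integral of \<open>f (x + t *\<^sub>R axis i 1)\<close> over \<open>x\<close> is constant in \<open>t\<close>.\<close>

lemma integral_partial_deriv_eq_0: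
  fixes f :: "real ^ 'n::finite \<Rightarrow> 'b::{banach, second_countable_topology}"
  assumes diff: "\<And>x. f differentiable (at x)" and cont: "continuous_on UNIV (partial_deriv i f)"
    and supp: "\<And>x. norm x > R \<Longrightarrow> f x = 0"
  shows "(LINT x|lborel. partial_deriv i f x) = 0"
proof -
  let ?a = "axis i 1 :: real ^ 'n"
  have cont_f: "continuous_on UNIV f"
    using diff by (meson differentiable_imp_continuous_within continuous_at_imp_continuous_on)
  have [measurable]: "f \<in> borel_measurable borel" "partial_deriv i f \<in> borel_measurable borel"
    by (auto intro: borel_measurable_continuous_onI cont_f cont)
  obtain M where M: "M \<ge> 0" "\<And>x. norm (partial_deriv i f x) \<le> M"
    using bounded_of_bounded_support[OF cont partial_deriv_eq_0[where f=f and R=R, OF supp]] by blast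
  \<comment> \<open>The mean value inequality bounds all difference quotients by \<open>M\<close>;
    this supplies the dominating function below.\<close>
  have lip: "norm (f (x + t *\<^sub>R ?a) - f x) \<le> M * t" if "t \<ge> 0" for x t
  proof -
    have "norm (f (x + t *\<^sub>R ?a) - f (x + 0 *\<^sub>R ?a)) \<le> M * norm (t - 0)"
    proof (rule differentiable_bound[where S="{0..t}" and f="\<lambda>t. f (x + t *\<^sub>R ?a)"
          and f'="\<lambda>s h. h *\<^sub>R partial_deriv i f (x + s *\<^sub>R ?a)"])
      show "((\<lambda>t. f (x + t *\<^sub>R ?a)) has_derivative (\<lambda>h. h *\<^sub>R partial_deriv i f (x + s *\<^sub>R ?a))) (at s within {0..t})" for s
        using has_vector_derivative_along_axis[where x=x and s=s and i=i, OF diff]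
        unfolding has_vector_derivative_def by (rule has_derivative_at_withinI)
      show "onorm (\<lambda>h. h *\<^sub>R partial_deriv i f (x + s *\<^sub>R ?a)) \<le> M" for s
        by (rule onorm_bound) (use M in \<open>simp_all add: mult.commute[of M] mult_left_mono\<close>)
    qed (use that in auto)
    then show ?thesis using that by simp
  qed
  define t where "t = (\<lambda>n. 1 / real (Suc n))"
  have t: "0 < t n" "t n \<le> 1" for n by (auto simp: t_def)
  have t0: "t \<longlonglongrightarrow> 0"
    using LIMSEQ_inverse_real_of_nat by (simp add: t_def inverse_eq_divide)
  define q where "q = (\<lambda>n x. (f (x + t n *\<^sub>R ?a) - f x) /\<^sub>R t n)"
  have int_f: "integrable lborel f"
    by (rule integrable_lborel_bounded_support[OF cont_f supp])
  have shift: "integrable lborel (\<lambda>x. f (x + c)) \<and> (LINT x|lborel. f (x + c)) = (LINT x|lborel. f x)" for c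
  proof -
    have "integrable (distr lborel borel ((+) c)) f" "(LINT x|distr lborel borel ((+) c). f x) = (LINT x|lborel. f x)"
      using int_f by (simp_all add: lborel_distr_plus)
    then show ?thesis by (simp add: integrable_distr_eq integral_distr add.commute)
  qed
  have q0: "(LINT x|lborel. q n x) = 0" for n
    using shift[of "t n *\<^sub>R ?a"] int_f by (simp add: q_def)
  \<comment> \<open>Since \<open>t n\<close> is at most 1, every difference quotient vanishes
    outside the ball of radius R + 1, so \<open>M\<close> times the indicator of that ball
    dominates.\<close>
  have "(\<lambda>n. LINT x|lborel. q n x) \<longlonglongrightarrow> (LINT x|lborel. partial_deriv i f x)"
  proof (rule integral_dominated_convergence[where w="\<lambda>x. indicator (cball 0 (R + 1)) x *\<^sub>R M"])
    show "integrable lborel (\<lambda>x::real ^ 'n. indicator (cball 0 (R + 1)) x *\<^sub>R M)"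
      by (rule borel_integrable_compact) auto
    show "AE x in lborel. (\<lambda>n. q n x) \<longlonglongrightarrow> partial_deriv i f x"
    proof (rule AE_I2)
      fix x
      have "((\<lambda>t. f (x + t *\<^sub>R ?a)) has_vector_derivative partial_deriv i f x) (at 0)"
        using has_vector_derivative_along_axis[where x=x and s=0 and i=i, OF diff] by simp
      then have "((\<lambda>t. norm (f (x + t *\<^sub>R ?a) - f x - t *\<^sub>R partial_deriv i f x) / norm t) \<longlongrightarrow> 0) (at 0)"
        by (simp add: has_vector_derivative_def has_derivative_at)
      then have "((\<lambda>t. norm ((f (x + t *\<^sub>R ?a) - f x) /\<^sub>R t - partial_deriv i f x)) \<longlongrightarrow> 0) (at 0)"
      proof (rule Lim_transform_eventually)
        have "norm (u - t *\<^sub>R D) / norm t = norm (u /\<^sub>R t - D)" if "t \<noteq> 0" for u D :: 'b and t :: real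
        proof -
          have "u /\<^sub>R t - D = (u - t *\<^sub>R D) /\<^sub>R t" using that by (simp add: scaleR_diff_right)
          then show ?thesis by (simp add: divide_inverse)
        qed
        then show "\<forall>\<^sub>F t in at 0. norm (f (x + t *\<^sub>R ?a) - f x - t *\<^sub>R partial_deriv i f x) / norm t =
            norm ((f (x + t *\<^sub>R ?a) - f x) /\<^sub>R t - partial_deriv i f x)"
          by (auto simp: eventually_at_filter)
      qed
      then have "((\<lambda>t. (f (x + t *\<^sub>R ?a) - f x) /\<^sub>R t) \<longlongrightarrow> partial_deriv i f x) (at 0)"
        by (rule LIM_zero_cancel[OF tendsto_norm_zero_cancel])
      then show "(\<lambda>n. q n x) \<longlonglongrightarrow> partial_deriv i f x"
        unfolding q_def
        by (rule filterlim_compose) (use t0 t(1)[THEN less_imp_neq[THEN not_sym]] in \<open>auto simp: filterlim_at intro!: always_eventually\<close>)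
    qed
    show "AE x in lborel. norm (q n x) \<le> indicator (cball 0 (R + 1)) x *\<^sub>R M" for n
    proof (rule AE_I2)
      fix x
      have "norm (t n *\<^sub>R ?a) \<le> 1" using t[of n] by simp
      then have "q n x = 0" if "norm x > R + 1"
        using that supp[of x] supp[of "x + t n *\<^sub>R ?a"] norm_diff_ineq[of x "t n *\<^sub>R ?a"]
        by (auto simp: q_def)
      moreover have "norm (q n x) \<le> M"
        using lip[of "t n" x] t[of n] unfolding q_def norm_scaleR by (simp add: field_simps)
      ultimately show "norm (q n x) \<le> indicator (cball 0 (R + 1)) x *\<^sub>R M"
        by (auto simp: indicator_def)
    qed
  qed (auto simp: q_def)
  then show ?thesis unfolding q0 by (simp add: LIMSEQ_const_iff)
qed

lemma partial_deriv_mult: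
  fixes f g :: "real ^ 'n::finite \<Rightarrow> 'b::real_normed_algebra"
  assumes "smooth f" "smooth g"
  shows "partial_deriv i (\<lambda>x. f x * g x) x = f x * partial_deriv i g x + partial_deriv i f x * g x"
proof (rule partial_deriv_eqI)
  have "((\<lambda>t. f (x + t *\<^sub>R axis i 1)) has_vector_derivative partial_deriv i f x) (at 0)"
    "((\<lambda>t. g (x + t *\<^sub>R axis i 1)) has_vector_derivative partial_deriv i g x) (at 0)"
    using assms smooth_differentiable has_vector_derivative_along_axis[of _ x 0 i] by fastforce+
  from has_vector_derivative_mult[OF this]
  show "((\<lambda>t. f (x + t *\<^sub>R axis i 1) * g (x + t *\<^sub>R axis i 1)) has_vector_derivative
      f x * partial_deriv i g x + partial_deriv i f x * g x) (at 0)"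
    by simp
qed

text \<open>The product \<open>f x * g x\<close> inherits bounded support from \<open>g\<close>, so
  its partial derivative integrates to 0; the product rule does the rest.\<close>

lemma integral_by_parts:
  fixes f g :: "real ^ 'n::finite \<Rightarrow> 'b::{real_normed_field, euclidean_space}"
  assumes f: "smooth f" and g: "test_function g"
  shows "(LINT x|lborel. f x * partial_deriv i g x) = - (LINT x|lborel. partial_deriv i f x * g x)"
proof -
  obtain R where R: "\<And>x. norm x > R \<Longrightarrow> g x = 0" and sg: "smooth g"
    using g by (auto simp: test_function_iff)
  note cont = smooth_continuous[OF f, of UNIV] smooth_continuous[OF sg, of UNIV]
    smooth_continuous[OF smooth_partial_deriv[OF f], of UNIV i]
    smooth_continuous[OF smooth_partial_deriv[OF sg], of UNIV i]
  have int: "integrable lborel (\<lambda>x. f x * partial_deriv i g x)" "integrable lborel (\<lambda>x. partial_deriv i f x * g x)"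
    by (rule integrable_lborel_bounded_support[where R=R];
        simp add: R partial_deriv_eq_0[of R g] cont continuous_on_mult)+
  have eq: "partial_deriv i (\<lambda>x. f x * g x) = (\<lambda>x. f x * partial_deriv i g x + partial_deriv i f x * g x)"
    using partial_deriv_mult[OF f sg] by blast
  have "(LINT x|lborel. partial_deriv i (\<lambda>x. f x * g x) x) = 0"
    by (rule integral_partial_deriv_eq_0[where R=R])
       (simp_all add: eq R cont continuous_on_mult continuous_on_add differentiable_mult
          smooth_differentiable[OF f] smooth_differentiable[OF sg])
  then show ?thesis using int by (simp add: eq eq_neg_iff_add_eq_0)
qed

text \<open>Each integration by parts moves one derivative from \<phi> onto the tensor product and
  raises one entry of \<open>e\<close>, which is why the induction leaves \<open>e\<close>
  arbitrary.\<close>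

lemma integral_tensor_foldr_partial_deriv:
  fixes \<phi> :: "real ^ 'n::finite \<Rightarrow> 'b::{real_normed_field, euclidean_space}"
  assumes F: "\<And>i::'n. deriv_chain (F i)" and \<phi>: "test_function \<phi>"
  shows "(LINT x|lborel. (tensor (\<lambda>i. F i (e i)) x *\<^sub>R v) * foldr partial_deriv js \<phi> x) =
    (- 1) ^ length js * (LINT x|lborel. (tensor (\<lambda>i. F i (e i + count_list js i)) x *\<^sub>R v) * \<phi> x)"
proof (induction js arbitrary: e)
  case (Cons j js)
  let ?e = "e(j := Suc (e j))"
  have e: "?e i + count_list js i = e i + count_list (j # js) i" for i by auto
  have "(LINT x|lborel. (tensor (\<lambda>i. F i (e i)) x *\<^sub>R v) * foldr partial_deriv (j # js) \<phi> x) =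
      - (LINT x|lborel. (tensor (\<lambda>i. F i (?e i)) x *\<^sub>R v) * foldr partial_deriv js \<phi> x)"
    using integral_by_parts[OF smooth_tensor[where F=F and e=e and v=v, OF F]
        test_function_foldr_partial_deriv[OF \<phi>, of js], of j]
    unfolding partial_deriv_tensor[OF F] by simp
  also have "\<dots> = (- 1) ^ length (j # js) *
      (LINT x|lborel. (tensor (\<lambda>i. F i (?e i + count_list js i)) x *\<^sub>R v) * \<phi> x)"
    unfolding Cons by simp
  finally show ?case unfolding e .
qed simp

subsection \<open>Lebesgue versus Borel measurability\<close>

text \<open>Done in coordinates: each real component has a Borel representative, and the finitely
  many exceptional null sets are united.\<close>

lemma lebesgue_borel_representative:
  fixes f :: "'a::euclidean_space \<Rightarrow> 'b::euclidean_space"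
  assumes "f \<in> borel_measurable lebesgue"
  shows "\<exists>f' \<in> borel_measurable borel. AE x in lebesgue. f x = f' x"
proof -
  have "\<forall>b. \<exists>g. g \<in> borel_measurable borel \<and> (AE x in lborel. f x \<bullet> b = g x)"
  proof
    fix b
    have "(\<lambda>x. f x \<bullet> b) \<in> borel_measurable lebesgue"
      using assms by measurable
    from completion_ex_borel_measurable_real[OF this]
    show "\<exists>g. g \<in> borel_measurable borel \<and> (AE x in lborel. f x \<bullet> b = g x)" by auto
  qed
  from choice[OF this] obtain g where g: "\<And>b. g b \<in> borel_measurable borel"
    "\<And>b. AE x in lborel. f x \<bullet> b = g b x" by auto
  have "AE x in lborel. \<forall>b\<in>Basis. f x \<bullet> b = g b x"
    by (subst AE_ball_countable) (auto intro: g countable_finite)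
  then have "AE x in lborel. f x = (\<Sum>b\<in>Basis. g b x *\<^sub>R b)"
  proof eventually_elim
    case (elim x)
    then show ?case using euclidean_representation[of "f x"] by simp
  qed
  then show ?thesis
    using g(1) by (intro bexI[of _ "\<lambda>x. \<Sum>b\<in>Basis. g b x *\<^sub>R b"]) (auto intro: AE_completion)
qed

text \<open>Lebesgue measure is complete, so measurability itself transfers along an almost
  everywhere equality. If one side is not integrable, neither is the other, and both integrals take
  the default value 0.\<close>

lemma integral_lebesgue_cong_AE:
  fixes f g :: "'a::euclidean_space \<Rightarrow> 'b::euclidean_space"
  assumes "AE x in lebesgue. f x = g x"
  shows "integrable lebesgue f \<longleftrightarrow> integrable lebesgue g" "integral\<^sup>L lebesgue f = integral\<^sup>L lebesgue g"
proof -
  have "AE x in lebesgue. g x = f x" using assms by (rule eventually_mono) simp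
  note meas = borel_measurable_AE[OF _ assms] borel_measurable_AE[OF _ this]
  show int: "integrable lebesgue f \<longleftrightarrow> integrable lebesgue g"
  proof
    assume f: "integrable lebesgue f"
    from borel_measurable_integrable[OF f] have "g \<in> borel_measurable lebesgue" by (rule meas)
    from integrable_cong_AE_imp[OF f this] assms show "integrable lebesgue g" .
  next
    assume g: "integrable lebesgue g"
    from borel_measurable_integrable[OF g] have "f \<in> borel_measurable lebesgue" by (rule meas)
    from integrable_cong_AE_imp[OF g this] \<open>AE x in lebesgue. g x = f x\<close> show "integrable lebesgue f"
      by simp
  qed
  show "integral\<^sup>L lebesgue f = integral\<^sup>L lebesgue g"
  proof (cases "integrable lebesgue f")
    case True
    then show ?thesis using int by (intro integral_cong_AE assms) auto
  next
    case False
    then show ?thesis using int by (simp add: not_integrable_integral_eq)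
  qed
qed

section \<open>Lebesgue measure and null sets under dilations\<close>

lemma lborel_dilation:
  assumes "r > 0"
  shows "(lborel :: 'a::euclidean_space measure) = density (distr lborel borel (\<lambda>x. r *\<^sub>R x)) (\<lambda>_. ennreal (r ^ DIM('a)))"
  using lborel_affine[of r "0 :: 'a"] assms by simp

lemma nn_integral_dilation:
  fixes f :: "'a::euclidean_space \<Rightarrow> ennreal"
  assumes [measurable]: "f \<in> borel_measurable borel" and r: "r > 0"
  shows "(\<integral>\<^sup>+x. f (x /\<^sub>R r) \<partial>lborel) = ennreal (r ^ DIM('a)) * (\<integral>\<^sup>+x. f x \<partial>lborel)"
  by (subst lborel_dilation[OF r]) (use r in \<open>simp add: nn_integral_density nn_integral_distr nn_integral_cmult\<close>)

lemma AE_dilation: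
  fixes P :: "'a::euclidean_space \<Rightarrow> bool"
  assumes "AE x in lebesgue. P x" and r: "r > 0"
  shows "AE x in lebesgue. P (x /\<^sub>R r)"
proof -
  have "AE x in lborel. P x" using assms(1) by (simp add: AE_completion_iff)
  then obtain N where N: "N \<in> null_sets lborel" "{x. \<not> P x} \<subseteq> N"
    by (auto elim!: AE_E simp: null_sets_def)
  then have [measurable]: "N \<in> sets borel" by auto
  have "(\<integral>\<^sup>+x. indicator N (x /\<^sub>R r) \<partial>lborel) = 0"
    using N(1) by (subst nn_integral_dilation[OF _ r]) auto
  then have "AE x in lborel. indicator N (x /\<^sub>R r) = (0::ennreal)"
    by (subst (asm) nn_integral_0_iff_AE) auto
  then have "AE x in lborel. P (x /\<^sub>R r)"
    by eventually_elim (use N(2) in \<open>auto simp: indicator_def split: if_splits\<close>)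
  then show ?thesis by (rule AE_completion)
qed

lemma integral_dilation:
  fixes f :: "'a::euclidean_space \<Rightarrow> 'b::euclidean_space"
  assumes f: "f \<in> borel_measurable lebesgue" and r: "r > 0"
  shows "(LINT x|lebesgue. f (x /\<^sub>R r)) = r ^ DIM('a) *\<^sub>R (LINT x|lebesgue. f x)"
proof -
  obtain f' where f'[measurable]: "f' \<in> borel_measurable borel" and eq: "AE x in lebesgue. f x = f' x"
    using lebesgue_borel_representative[OF f] by blast
  have "(LINT x|lebesgue. f (x /\<^sub>R r)) = (LINT x|lebesgue. f' (x /\<^sub>R r))"
    by (rule integral_lebesgue_cong_AE(2)[OF AE_dilation[OF eq r]])
  also have "\<dots> = (LINT x|lborel. f' (x /\<^sub>R r))"
    by (rule integral_completion) simp
  also have "\<dots> = r ^ DIM('a) *\<^sub>R (LINT x|lborel. f' x)"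
    by (subst lborel_dilation[OF r]) (use r in \<open>simp add: integral_density integral_distr\<close>)
  also have "(LINT x|lborel. f' x) = (LINT x|lebesgue. f' x)"
    by (rule integral_completion[symmetric]) simp
  also have "\<dots> = (LINT x|lebesgue. f x)"
    by (rule integral_lebesgue_cong_AE(2)[symmetric, OF eq])
  finally show ?thesis .
qed

text \<open>
  A Lebesgue measurable \<open>f\<close> may be replaced by a Borel representative in \<open>f (x /\<^sub>R norm y)\<close>; the
  composition itself need not be jointly measurable.
\<close>

lemma AE_AE_dilation_norm:
  fixes P :: "'a::euclidean_space \<Rightarrow> bool"
  assumes "AE x in lebesgue. P x"
  shows "AE x in lebesgue. AE y in lebesgue. P (x /\<^sub>R norm (y :: 'a))"
proof -
  have "AE x in lborel. P x" using assms(1) by (simp add: AE_completion_iff)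
  then obtain N where N: "N \<in> null_sets lborel" "{x. \<not> P x} \<subseteq> N"
    by (auto elim!: AE_E simp: null_sets_def)
  then have [measurable]: "N \<in> sets borel" by auto
  have 0: "(\<integral>\<^sup>+x. indicator N (x /\<^sub>R norm y) \<partial>lborel) = 0" if "y \<noteq> 0" for y :: 'a
    using N(1) that by (subst nn_integral_dilation) auto
  \<comment> \<open>The point y = 0 must be left out: there \<open>x /\<^sub>R norm y\<close> is 0
    for every x, and 0 may belong to \<open>N\<close>.\<close>
  have "AE y in lborel. (\<integral>\<^sup>+x. indicator N (x /\<^sub>R norm (y::'a)) \<partial>lborel) = 0"
    using AE_lborel_singleton[of "0::'a"] by (rule eventually_mono) (rule 0)
  then have "(\<integral>\<^sup>+y. (\<integral>\<^sup>+x. indicator N (x /\<^sub>R norm (y::'a)) \<partial>lborel) \<partial>lborel) = 0"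
    by (subst nn_integral_0_iff_AE) measurable
  \<comment> \<open>Tonelli exchanges the sections: almost all sections at fixed y are null, hence
    almost all sections at fixed x are null.\<close>
  then have "(\<integral>\<^sup>+x. (\<integral>\<^sup>+y. indicator N (x /\<^sub>R norm (y::'a)) \<partial>lborel) \<partial>lborel) = 0"
    by (subst (asm) lborel_pair.Fubini') measurable
  then have "AE x in lborel. (\<integral>\<^sup>+y. indicator N (x /\<^sub>R norm (y::'a)) \<partial>lborel) = 0"
    by (subst (asm) nn_integral_0_iff_AE) measurable
  then have "AE x in lborel. AE y in lebesgue. P (x /\<^sub>R norm (y :: 'a))"
  proof eventually_elim
    case (elim x)
    then have "AE y in lborel. indicator N (x /\<^sub>R norm (y::'a)) = (0::ennreal)"
      by (subst (asm) nn_integral_0_iff_AE) measurable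
    then have "AE y in lborel. P (x /\<^sub>R norm (y :: 'a))"
      by eventually_elim (use N(2) in \<open>auto simp: indicator_def split: if_splits\<close>)
    then show ?case by (rule AE_completion)
  qed
  then show ?thesis by (rule AE_completion)
qed

subsection \<open>Weak derivatives are unique\<close>

text \<open>The truncations to balls of integer radius are measurable, and at each point they are
  eventually equal to \<open>f\<close>.\<close>

lemma locally_integrable_measurable:
  assumes "locally_integrable f"
  shows "f \<in> borel_measurable lebesgue"
proof (rule borel_measurable_LIMSEQ_metric)
  fix m :: nat
  show "(\<lambda>x. indicator (cball 0 (real m)) x *\<^sub>R f x) \<in> borel_measurable lebesgue"
    using assms[unfolded locally_integrable_def, rule_format, of "cball 0 (real m)"]
    by (auto simp: set_integrable_def)
next
  fix x :: "real ^ 'a"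
  obtain M where "norm x \<le> real M" using real_arch_simple by blast
  then have "\<forall>\<^sub>F m in sequentially. indicator (cball 0 (real m)) x *\<^sub>R f x = f x"
    by (intro eventually_sequentiallyI[of M]) (auto simp: indicator_def)
  then show "(\<lambda>m. indicator (cball 0 (real m)) x *\<^sub>R f x) \<longlonglongrightarrow> f x"
    by (rule tendsto_eventually)
qed

lemma integrable_imp_locally_integrable:
  assumes "integrable lebesgue f"
  shows "locally_integrable f"
  unfolding locally_integrable_def set_integrable_def
  using assms by (auto intro: integrable_mult_indicator lmeasurable_compact[THEN fmeasurableD])

lemma test_function_bounded:
  "test_function \<phi> \<Longrightarrow> \<exists>M\<ge>0. \<forall>x. norm (\<phi> x) \<le> M"
  using bounded_of_bounded_support smooth_continuous unfolding test_function_iff by blast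

lemma test_function_measurable: "test_function \<phi> \<Longrightarrow> \<phi> \<in> borel_measurable borel"
  using borel_measurable_continuous_onI smooth_continuous unfolding test_function_iff by blast

lemma integrable_mult_test_function:
  fixes f :: "real ^ 'n::finite \<Rightarrow> 'b::{real_normed_field, euclidean_space}"
  assumes f: "locally_integrable f" and \<phi>: "test_function \<phi>"
  shows "integrable lebesgue (\<lambda>x. f x * \<phi> x)"
proof -
  obtain M where M: "M \<ge> 0" "\<And>x. norm (\<phi> x) \<le> M" using test_function_bounded[OF \<phi>] by blast
  obtain R where R: "\<And>x. norm x > R \<Longrightarrow> \<phi> x = 0" using \<phi> by (auto simp: test_function_iff)
  have int: "integrable lebesgue (\<lambda>x. M *\<^sub>R (indicator (cball 0 R) x *\<^sub>R f x))"
    using f unfolding locally_integrable_def set_integrable_def by (intro integrable_scaleR_right) auto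
  show ?thesis
  proof (rule Bochner_Integration.integrable_bound[OF int])
    show "(\<lambda>x. f x * \<phi> x) \<in> borel_measurable lebesgue"
      by (intro borel_measurable_times locally_integrable_measurable f measurable_completion)
         (simp add: test_function_measurable \<phi>)
    show "AE x in lebesgue. norm (f x * \<phi> x) \<le> norm (M *\<^sub>R (indicator (cball 0 R) x *\<^sub>R f x))"
    proof (rule AE_I2)
      fix x
      show "norm (f x * \<phi> x) \<le> norm (M *\<^sub>R (indicator (cball 0 R) x *\<^sub>R f x))"
        using R[of x] M mult_left_mono[OF M(2)[of x], of "norm (f x)"]
        by (cases "norm x \<le> R") (auto simp: norm_mult mult.commute)
    qed
  qed
qed

text \<open>Boxes are an intersection-stable generator of the Borel sets, so a Dynkin argument
  carries vanishing integrals from boxes to Borel sets. Cutting \<open>u\<close> off to a fixed box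
  first makes it integrable on the whole space, as complements and countable unions require.\<close>

lemma AE_eq_0_of_box_integrals:
  fixes u :: "'a::euclidean_space \<Rightarrow> 'b::{banach, second_countable_topology}"
  assumes meas[measurable]: "u \<in> borel_measurable borel"
    and int: "\<And>a b. integrable lborel (\<lambda>x. indicator (box a b) x *\<^sub>R u x)"
    and zero: "\<And>a b. (LINT x|lborel. indicator (box a b) x *\<^sub>R u x) = 0"
  shows "AE x in lborel. u x = 0"
proof -
  have "AE x in lborel. indicator (box p q) x *\<^sub>R u x = 0" for p q
  proof (rule sigma_finite_measure.density_zero[OF lborel.sigma_finite_measure_axioms int])
    let ?v = "\<lambda>x. indicator (box p q) x *\<^sub>R u x"
    have ind: "integrable lborel (\<lambda>x. indicator A x *\<^sub>R ?v x)" if "A \<in> sets borel" for A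
      using that by (intro integrable_mult_indicator int) auto
    fix A :: "'a set" assume "A \<in> sets lborel"
    then have A: "A \<in> sigma_sets UNIV (range (\<lambda>(a, b). box a b))"
      unfolding borel_eq_box by (simp add: borel_eq_box)
    have "Int_stable (range (\<lambda>(a, b::'a). box a b))"
      by (auto simp: Int_stable_def box_Int_box)
    moreover have "range (\<lambda>(a, b::'a). box a b) \<subseteq> Pow UNIV" by simp
    ultimately have "set_lebesgue_integral lborel A ?v = 0"
      using A
    proof (induction rule: sigma_sets_induct_disjoint)
      case (basic A)
      then obtain a b where "A = box a b" by auto
      moreover obtain c d where "box a b \<inter> box p q = box c d" by (auto simp: box_Int_box)
      ultimately have "(\<lambda>x. indicator A x *\<^sub>R ?v x) = (\<lambda>x. indicator (box c d) x *\<^sub>R u x)"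
        by (auto simp: indicator_def fun_eq_iff)
      then show ?case using zero[of c d] unfolding set_lebesgue_integral_def by simp
    next
      case (compl A)
      then have [measurable]: "A \<in> sets borel" by (simp add: borel_eq_box)
      have "set_lebesgue_integral lborel (UNIV - A) ?v =
          (LINT x|lborel. ?v x - indicator A x *\<^sub>R ?v x)"
        unfolding set_lebesgue_integral_def
        by (intro Bochner_Integration.integral_cong) (auto simp: indicator_def)
      also have "\<dots> = 0"
        using compl int ind[of A] zero by (simp add: set_lebesgue_integral_def)
      finally show ?case .
    next
      case (union A)
      then have [measurable]: "\<And>i. A i \<in> sets borel" by (auto simp: borel_eq_box)
      have "set_lebesgue_integral lborel (\<Union>i. A i) ?v = (\<Sum>i. set_lebesgue_integral lborel (A i) ?v)"
        by (rule lebesgue_integral_countable_add)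
           (use union(1) ind[of "\<Union>i. A i"] in \<open>auto simp: disjoint_family_on_def set_integrable_def\<close>)
      then show ?case using union by simp
    qed (simp_all add: set_lebesgue_integral_def)
    then show "set_lebesgue_integral lborel A ?v = 0" .
  qed
  then have "AE x in lborel. \<forall>m::nat. indicator (box (- (real m *\<^sub>R One)) (real m *\<^sub>R One)) x *\<^sub>R u x = 0"
    by (subst AE_all_countable) blast
  then show ?thesis
  proof eventually_elim
    case (elim x)
    have "x \<in> (\<Union>m::nat. box (- (real m *\<^sub>R One)) (real m *\<^sub>R One))"
      unfolding UN_box_eq_UNIV ..
    then obtain m :: nat where "x \<in> box (- (real m *\<^sub>R One)) (real m *\<^sub>R One)" by (rule UN_E)
    then show ?case using elim[rule_format, of m] by simp
  qed
qed

text \<open>Tensor products of bumps with parameter tending to 0 converge to the indicator of a box,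
  so testing against them yields the integrals of \<open>u\<close> over boxes.\<close>

lemma AE_eq_0_of_test_functions:
  fixes u :: "real ^ 'n::finite \<Rightarrow> 'b::{real_normed_field, euclidean_space}"
  assumes u: "locally_integrable u"
    and zero: "\<And>\<phi>. test_function \<phi> \<Longrightarrow> (LINT x|lebesgue. u x * \<phi> x) = 0"
  shows "AE x in lebesgue. u x = 0"
proof -
  obtain u' where u'[measurable]: "u' \<in> borel_measurable borel" and eq: "AE x in lebesgue. u x = u' x"
    using lebesgue_borel_representative[OF locally_integrable_measurable[OF u]] by blast
  \<comment> \<open>Closed boxes are compact, so local integrability applies to them; they dominate
    the open boxes to whose indicators the bumps converge.\<close>
  have int_c: "integrable lborel (\<lambda>x. indicator (cbox a b) x *\<^sub>R u' x)" for a b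
  proof -
    have "integrable lebesgue (\<lambda>x. indicator (cbox a b) x *\<^sub>R u x)"
      using u by (simp add: locally_integrable_def set_integrable_def)
    then have "integrable lebesgue (\<lambda>x. indicator (cbox a b) x *\<^sub>R u' x)"
      by (subst (asm) integral_lebesgue_cong_AE(1)) (use eq in auto)
    then show ?thesis by (subst (asm) integrable_completion) measurable
  qed
  have "AE x in lborel. u' x = 0"
  proof (rule AE_eq_0_of_box_integrals)
    fix a b :: "real ^ 'n"
    have bound: "norm (indicator (box a b) x *\<^sub>R u' x) \<le> norm (indicator (cbox a b) x *\<^sub>R u' x)" for x
      using box_subset_cbox by (auto simp: indicator_def)
    show "integrable lborel (\<lambda>x. indicator (box a b) x *\<^sub>R u' x)"
      by (rule Bochner_Integration.integrable_bound[OF int_c[of a b]]) (use bound in auto)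
    define \<phi> where "\<phi> = (\<lambda>m. tensor (\<lambda>i. bump (1 / real (Suc m)) (a $ i) (b $ i)))"
    have \<phi>: "test_function (\<lambda>x. \<phi> m x *\<^sub>R (1::'b))" for m
      unfolding \<phi>_def by (rule bump_tensor_test_function) simp
    have \<phi>_bounds: "0 \<le> \<phi> m x" "\<phi> m x \<le> 1" "x \<notin> box a b \<Longrightarrow> \<phi> m x = 0" for m x
      unfolding \<phi>_def by (rule bump_tensor_bounds; simp)+
    have [measurable]: "(\<lambda>x. \<phi> m x *\<^sub>R (1::'b)) \<in> borel_measurable borel" for m
      by (rule test_function_measurable[OF \<phi>])
    have "(LINT x|lborel. u' x * (\<phi> m x *\<^sub>R 1)) = 0" for m
    proof -
      have "(LINT x|lborel. u' x * (\<phi> m x *\<^sub>R 1)) = (LINT x|lebesgue. u' x * (\<phi> m x *\<^sub>R 1))"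
        by (rule integral_completion[symmetric]) measurable
      also have "\<dots> = (LINT x|lebesgue. u x * (\<phi> m x *\<^sub>R 1))"
        by (rule integral_lebesgue_cong_AE(2)) (use eq in auto)
      finally show ?thesis using zero[OF \<phi>] by simp
    qed
    moreover have "(\<lambda>m. LINT x|lborel. u' x * (\<phi> m x *\<^sub>R 1)) \<longlonglongrightarrow> (LINT x|lborel. indicator (box a b) x *\<^sub>R u' x)"
    proof (rule integral_dominated_convergence[where w="\<lambda>x. norm (indicator (cbox a b) x *\<^sub>R u' x)"])
      show "integrable lborel (\<lambda>x. norm (indicator (cbox a b) x *\<^sub>R u' x))"
        using int_c by (rule integrable_norm)
      show "AE x in lborel. (\<lambda>m. u' x * (\<phi> m x *\<^sub>R 1)) \<longlonglongrightarrow> indicator (box a b) x *\<^sub>R u' x"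
      proof (rule AE_I2)
        fix x
        have "(\<lambda>m. \<phi> m x) \<longlonglongrightarrow> indicator (box a b) x"
          unfolding \<phi>_def by (rule bump_tensor_tendsto_indicator)
        then show "(\<lambda>m. u' x * (\<phi> m x *\<^sub>R 1)) \<longlonglongrightarrow> indicator (box a b) x *\<^sub>R u' x"
          by (simp add: tendsto_scaleR)
      qed
      show "AE x in lborel. norm (u' x * (\<phi> m x *\<^sub>R 1)) \<le> norm (indicator (cbox a b) x *\<^sub>R u' x)" for m
      proof (rule AE_I2)
        fix x
        show "norm (u' x * (\<phi> m x *\<^sub>R 1)) \<le> norm (indicator (cbox a b) x *\<^sub>R u' x)"
          using \<phi>_bounds(1,2)[of m x] \<phi>_bounds(3)[of x m] box_subset_cbox[of a b]
          by (cases "x \<in> box a b") (auto simp: mult_left_le_one_le)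
      qed
    qed measurable
    ultimately show "(LINT x|lborel. indicator (box a b) x *\<^sub>R u' x) = 0"
      by (simp add: LIMSEQ_const_iff)
  qed simp
  then have "AE x in lebesgue. u' x = 0" by (rule AE_completion)
  with eq show ?thesis by eventually_elim simp
qed

lemma has_weak_deriv_unique:
  assumes g: "has_weak_deriv \<alpha> f g" and h: "has_weak_deriv \<alpha> f h"
  shows "AE x in lebesgue. g x = h x"
proof -
  have loc: "locally_integrable g" "locally_integrable h"
    using g h by (auto simp: has_weak_deriv_def)
  have "AE x in lebesgue. g x - h x = 0"
  proof (rule AE_eq_0_of_test_functions)
    show "locally_integrable (\<lambda>x. g x - h x)"
      using loc unfolding locally_integrable_def by (auto intro: set_integral_diff)
    fix \<phi> :: "real ^ 'a \<Rightarrow> 'b" assume \<phi>: "test_function \<phi>"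
    have "(LINT x|lebesgue. g x * \<phi> x) = (LINT x|lebesgue. h x * \<phi> x)"
      using g h \<phi> by (auto simp: has_weak_deriv_def)
    then show "(LINT x|lebesgue. (g x - h x) * \<phi> x) = 0"
      using integrable_mult_test_function[OF loc(1) \<phi>] integrable_mult_test_function[OF loc(2) \<phi>]
      by (simp add: left_diff_distrib)
  qed
  then show ?thesis by simp
qed

lemma has_weak_deriv_weak_deriv: "has_weak_deriv \<alpha> f g \<Longrightarrow> has_weak_deriv \<alpha> f (weak_deriv \<alpha> f)"
  unfolding weak_deriv_def by (rule someI[of "has_weak_deriv \<alpha> f"])

text \<open>The choice made in \<open>weak_deriv\<close> does not ask for integrability; uniqueness
  carries it over from the integrable weak derivative that membership in \<open>sobolev k\<close>
  provides.\<close>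

lemma sobolev_weak_deriv:
  assumes "f \<in> sobolev k" "multi_order \<alpha> \<le> k"
  shows "has_weak_deriv \<alpha> f (weak_deriv \<alpha> f)" "integrable lebesgue (weak_deriv \<alpha> f)"
proof -
  obtain g where g: "has_weak_deriv \<alpha> f g" "integrable lebesgue g"
    using assms by (auto simp: sobolev_def)
  from g(1) show *: "has_weak_deriv \<alpha> f (weak_deriv \<alpha> f)" by (rule has_weak_deriv_weak_deriv)
  show "integrable lebesgue (weak_deriv \<alpha> f)"
    using g(2) integral_lebesgue_cong_AE(1)[OF has_weak_deriv_unique[OF g(1) *]] by simp
qed

subsection \<open>Dilations of test functions and of weak derivatives\<close>

lemma partial_deriv_dilation:
  fixes f :: "real ^ 'n::finite \<Rightarrow> 'b::real_normed_vector"
  assumes "\<And>x. f differentiable (at x)"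
  shows "partial_deriv i (\<lambda>x. f (r *\<^sub>R x)) = (\<lambda>x. r *\<^sub>R partial_deriv i f (r *\<^sub>R x))"
proof (intro ext partial_deriv_eqI)
  fix x :: "real ^ 'n"
  have "((\<lambda>t. f (r *\<^sub>R x + t *\<^sub>R axis i 1)) has_vector_derivative partial_deriv i f (r *\<^sub>R x)) (at (r * 0))"
    using has_vector_derivative_along_axis[where x="r *\<^sub>R x" and s=0 and i=i, OF assms] by simp
  moreover have "((\<lambda>t. r * t) has_vector_derivative r) (at 0)"
    by (auto intro!: derivative_eq_intros)
  ultimately have "((\<lambda>t. f (r *\<^sub>R x + t *\<^sub>R axis i 1)) \<circ> (\<lambda>t. r * t) has_vector_derivative
      r *\<^sub>R partial_deriv i f (r *\<^sub>R x)) (at 0)"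
    by (intro vector_diff_chain_at)
  then show "((\<lambda>t. f (r *\<^sub>R (x + t *\<^sub>R axis i 1))) has_vector_derivative
      r *\<^sub>R partial_deriv i f (r *\<^sub>R x)) (at 0)"
    by (simp add: comp_def scaleR_add_right)
qed

lemma partial_deriv_scaleR:
  fixes f :: "real ^ 'n::finite \<Rightarrow> 'b::real_normed_vector"
  assumes "\<And>x. f differentiable (at x)"
  shows "partial_deriv i (\<lambda>x. c *\<^sub>R f x) = (\<lambda>x. c *\<^sub>R partial_deriv i f x)"
proof (intro ext partial_deriv_eqI)
  fix x :: "real ^ 'n"
  have "((\<lambda>t. f (x + t *\<^sub>R axis i 1)) has_vector_derivative partial_deriv i f x) (at 0)"
    using has_vector_derivative_along_axis[where x=x and s=0 and i=i, OF assms] by simp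
  then show "((\<lambda>t. c *\<^sub>R f (x + t *\<^sub>R axis i 1)) has_vector_derivative c *\<^sub>R partial_deriv i f x) (at 0)"
    by (rule bounded_linear.has_vector_derivative[OF bounded_linear_scaleR_right])
qed

lemma differentiable_dilation:
  fixes f :: "real ^ 'n::finite \<Rightarrow> 'b::real_normed_vector"
  assumes "\<And>x. f differentiable (at x)"
  shows "(\<lambda>x. f (r *\<^sub>R x)) differentiable (at x)"
  by (rule differentiable_compose[of f]) (use assms in \<open>auto intro: differentiable_at_withinI\<close>)

lemma foldr_partial_deriv_dilation:
  fixes f :: "real ^ 'n::finite \<Rightarrow> 'b::real_normed_vector"
  assumes f: "smooth f"
  shows "foldr partial_deriv is (\<lambda>x. f (r *\<^sub>R x)) = (\<lambda>x. r ^ length is *\<^sub>R foldr partial_deriv is f (r *\<^sub>R x))"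
proof (induction "is")
  case (Cons i "is")
  have diff: "foldr partial_deriv is f differentiable (at x)" for x
    by (rule smooth_differentiable[OF smooth_foldr_partial_deriv[OF f]])
  show ?case
    by (simp add: Cons partial_deriv_scaleR[OF differentiable_dilation[OF diff]] partial_deriv_dilation[OF diff] mult.commute)
qed simp

lemma test_function_dilation:
  fixes \<phi> :: "real ^ 'n::finite \<Rightarrow> 'b::real_normed_vector"
  assumes \<phi>: "test_function \<phi>" and r: "r > 0"
  shows "test_function (\<lambda>x. \<phi> (r *\<^sub>R x))"
proof -
  obtain R where R: "\<And>x. norm x > R \<Longrightarrow> \<phi> x = 0" and s: "smooth \<phi>"
    using \<phi> by (auto simp: test_function_iff)
  have "(\<lambda>x. r ^ length is *\<^sub>R foldr partial_deriv is \<phi> (r *\<^sub>R x)) differentiable (at x)" for "is" x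
    by (intro differentiable_scaleR differentiable_const differentiable_dilation
        smooth_differentiable smooth_foldr_partial_deriv s)
  then have "smooth (\<lambda>x. \<phi> (r *\<^sub>R x))"
    unfolding smooth_def foldr_partial_deriv_dilation[OF s] by (simp add: differentiable_on_def)
  moreover have "\<phi> (r *\<^sub>R x) = 0" if "norm x > R / r" for x
    using R[of "r *\<^sub>R x"] that r by (simp add: field_simps)
  ultimately show ?thesis unfolding test_function_iff by blast
qed

text \<open>Substituting x -> r x on both sides gives the Jacobian \<open>r ^ CARD('n)\<close>
  twice, and it cancels. What remains is the power of \<open>r\<close> from the chain rule for the
  dilated test function.\<close>

lemma has_weak_deriv_dilation:
  fixes f g :: "real ^ 'n::finite \<Rightarrow> 'b::{real_normed_field, euclidean_space}"
  assumes fg: "has_weak_deriv \<alpha> f g" and \<phi>: "test_function \<phi>" and r: "r > 0"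
  shows "(LINT x|lebesgue. f (x /\<^sub>R r) * multi_deriv \<alpha> \<phi> x) =
    (- 1) ^ multi_order \<alpha> * ((1 / r ^ multi_order \<alpha>) *\<^sub>R (LINT x|lebesgue. g (x /\<^sub>R r) * \<phi> x))"
proof -
  let ?m = "multi_order \<alpha>" and ?\<phi> = "\<lambda>x. \<phi> (r *\<^sub>R x)"
  have meas: "f \<in> borel_measurable lebesgue" "g \<in> borel_measurable lebesgue"
    using fg by (auto simp: has_weak_deriv_def intro: locally_integrable_measurable)
  have s: "smooth \<phi>" using \<phi> by (auto simp: test_function_iff)
  have D: "multi_deriv \<alpha> ?\<phi> x = r ^ ?m *\<^sub>R multi_deriv \<alpha> \<phi> (r *\<^sub>R x)" for x
    unfolding multi_deriv_eq_foldr foldr_partial_deriv_dilation[OF s] length_multi_list ..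
  have cont: "(\<lambda>x. h (r *\<^sub>R x)) \<in> borel_measurable lebesgue"
    if "test_function h" for h :: "real ^ 'n \<Rightarrow> 'b"
    using test_function_measurable[OF test_function_dilation[OF that r]] by (intro measurable_completion) simp
  have dil: "(LINT x|lebesgue. u (x /\<^sub>R r) * h x) = r ^ CARD('n) *\<^sub>R (LINT x|lebesgue. u x * h (r *\<^sub>R x))"
    if "u \<in> borel_measurable lebesgue" "test_function h" for u h :: "real ^ 'n \<Rightarrow> 'b"
    using integral_dilation[OF borel_measurable_times[OF that(1) cont[OF that(2)]] r] r by simp
  have "(LINT x|lebesgue. f x * multi_deriv \<alpha> ?\<phi> x) = (- 1) ^ ?m * (LINT x|lebesgue. g x * ?\<phi> x)"
    using fg test_function_dilation[OF \<phi> r] by (auto simp: has_weak_deriv_def)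
  then have "r ^ ?m *\<^sub>R (LINT x|lebesgue. f x * multi_deriv \<alpha> \<phi> (r *\<^sub>R x)) = (- 1) ^ ?m * (LINT x|lebesgue. g x * ?\<phi> x)"
    unfolding D by simp
  then have *: "(LINT x|lebesgue. f x * multi_deriv \<alpha> \<phi> (r *\<^sub>R x)) =
      (- 1) ^ ?m * ((1 / r ^ ?m) *\<^sub>R (LINT x|lebesgue. g x * ?\<phi> x))"
    using r by (auto simp: divideR_right[symmetric] inverse_eq_divide)
  have "test_function (multi_deriv \<alpha> \<phi>)"
    unfolding multi_deriv_eq_foldr by (rule test_function_foldr_partial_deriv[OF \<phi>])
  from dil[OF meas(1) this] dil[OF meas(2) \<phi>] show ?thesis
    unfolding * by (simp add: scaleR_left_commute)
qed

subsection \<open>The Hausdorff operator on integrable functions\<close>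

context
  fixes w :: "real ^ 'n::finite \<Rightarrow> real"
  assumes w_meas[measurable]: "w \<in> borel_measurable borel" and w_nonneg: "\<And>y. w y \<ge> 0"
    and w_int: "integrable lborel (\<lambda>y. norm y ^ CARD('n) * w y)"
begin

text \<open>Integrating over x first, the dilation contributes |y|^n times the L1 norm of
  \<open>f\<close>, so \<open>w_int\<close> is exactly what makes the double integral finite. The
  weight \<open>w\<close> is kept general because it will also stand for the weights with a negative
  power of |y|.\<close>

lemma integrable_hausdorff_pair:
  fixes f \<psi> :: "real ^ 'n \<Rightarrow> 'b::{real_normed_field, euclidean_space}"
  assumes f: "integrable lborel f" and [measurable]: "\<psi> \<in> borel_measurable borel"
    and M: "\<And>x. norm (\<psi> x) \<le> M"
  shows "integrable (lborel \<Otimes>\<^sub>M lborel) (\<lambda>(x, y). w y *\<^sub>R (f (x /\<^sub>R norm y) * \<psi> x))"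
proof (rule integrableI_bounded)
  have [measurable]: "f \<in> borel_measurable borel"
    using borel_measurable_integrable[OF f] by simp
  show "(\<lambda>(x, y). w y *\<^sub>R (f (x /\<^sub>R norm y) * \<psi> x)) \<in> borel_measurable (lborel \<Otimes>\<^sub>M lborel)"
    by measurable
  have M0: "M \<ge> 0" using norm_ge_zero M order_trans by blast
  let ?F = "\<integral>\<^sup>+x. ennreal (norm (f x)) \<partial>lborel"
  have le: "(\<integral>\<^sup>+x. ennreal (norm (w y *\<^sub>R (f (x /\<^sub>R norm y) * \<psi> x))) \<partial>lborel) \<le>
      ennreal (norm y ^ CARD('n) * w y) * (ennreal M * ?F)" if "y \<noteq> 0" for y
  proof -
    have "(\<integral>\<^sup>+x. ennreal (norm (w y *\<^sub>R (f (x /\<^sub>R norm y) * \<psi> x))) \<partial>lborel) \<le>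
        (\<integral>\<^sup>+x. ennreal (w y * M) * ennreal (norm (f (x /\<^sub>R norm y))) \<partial>lborel)"
    proof (intro nn_integral_mono)
      fix x
      have "norm (w y *\<^sub>R (f (x /\<^sub>R norm y) * \<psi> x)) \<le> w y * M * norm (f (x /\<^sub>R norm y))"
        using mult_left_mono[OF M[of x], of "w y * norm (f (x /\<^sub>R norm y))"] w_nonneg[of y]
        by (simp add: norm_mult mult_ac)
      then show "ennreal (norm (w y *\<^sub>R (f (x /\<^sub>R norm y) * \<psi> x))) \<le> ennreal (w y * M) * ennreal (norm (f (x /\<^sub>R norm y)))"
        using w_nonneg[of y] M0 by (simp add: ennreal_mult[symmetric] ennreal_leI)
    qed
    also have "\<dots> = ennreal (w y * M) * (ennreal (norm y ^ CARD('n)) * ?F)"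
      using nn_integral_dilation[of "\<lambda>x. ennreal (norm (f x))" "norm y"] that
      by (simp add: nn_integral_cmult)
    also have "\<dots> = ennreal (norm y ^ CARD('n) * w y) * (ennreal M * ?F)"
      using w_nonneg[of y] M0 by (simp add: ennreal_mult mult_ac)
    finally show ?thesis .
  qed
  have "(\<integral>\<^sup>+ z. ennreal (norm (case z of (x, y) \<Rightarrow> w y *\<^sub>R (f (x /\<^sub>R norm y) * \<psi> x))) \<partial>(lborel \<Otimes>\<^sub>M lborel))
      = (\<integral>\<^sup>+y. (\<integral>\<^sup>+x. ennreal (norm (w y *\<^sub>R (f (x /\<^sub>R norm y) * \<psi> x))) \<partial>lborel) \<partial>lborel)"
    by (subst lborel_pair.nn_integral_snd[symmetric]) simp_all
  also have "\<dots> \<le> (\<integral>\<^sup>+y. ennreal (norm y ^ CARD('n) * w y) * (ennreal M * ?F) \<partial>lborel)"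
    by (intro nn_integral_mono_AE) (use AE_lborel_singleton[of "0::real ^ 'n"] le in \<open>auto elim: eventually_mono\<close>)
  also have "\<dots> = (\<integral>\<^sup>+y. ennreal (norm y ^ CARD('n) * w y) \<partial>lborel) * (ennreal M * ?F)"
    by (rule nn_integral_multc) simp
  also have "\<dots> < \<infinity>"
    using w_int f w_nonneg by (simp add: integrable_iff_bounded ennreal_mult_less_top)
  finally show "(\<integral>\<^sup>+ z. ennreal (norm (case z of (x, y) \<Rightarrow> w y *\<^sub>R (f (x /\<^sub>R norm y) * \<psi> x))) \<partial>(lborel \<Otimes>\<^sub>M lborel)) < \<infinity>" .
qed

text \<open>The four facts are proved together because they rest on the same Borel representative
  \<open>f'\<close> and the same application of Fubini; the results are then carried back to
  \<open>f\<close> almost everywhere.\<close>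

lemma hausdorff_integrable:
  fixes f :: "real ^ 'n \<Rightarrow> 'b::{real_normed_field, euclidean_space}"
  assumes f: "integrable lebesgue f"
  shows hausdorff_converges: "AE x in lebesgue. integrable lebesgue (\<lambda>y. w y *\<^sub>R f (x /\<^sub>R norm y))"
    and integrable_hausdorff_op: "integrable lebesgue (hausdorff_op w f)"
    and hausdorff_op_L1_bound: "(LINT x|lebesgue. norm (hausdorff_op w f x)) \<le>
      (LINT y|lborel. norm y ^ CARD('n) * w y) * (LINT x|lebesgue. norm (f x))"
    and integral_hausdorff_op_mult: "\<lbrakk>\<psi> \<in> borel_measurable borel; \<And>x. norm (\<psi> x) \<le> M\<rbrakk> \<Longrightarrow>
      integrable lebesgue (\<lambda>y. w y *\<^sub>R (LINT x|lebesgue. f (x /\<^sub>R norm y) * \<psi> x)) \<and>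
      (LINT x|lebesgue. hausdorff_op w f x * \<psi> x) =
        (LINT y|lebesgue. w y *\<^sub>R (LINT x|lebesgue. f (x /\<^sub>R norm y) * \<psi> x))"
proof -
  obtain f' where f'[measurable]: "f' \<in> borel_measurable borel" and eq: "AE x in lebesgue. f x = f' x"
    using lebesgue_borel_representative[OF borel_measurable_integrable[OF f]] by blast
  have int_f': "integrable lborel f'"
    using f integral_lebesgue_cong_AE(1)[OF eq] by (subst (asm) integrable_completion) simp_all
  have pair: "integrable (lborel \<Otimes>\<^sub>M lborel) (\<lambda>(x, y). w y *\<^sub>R f' (x /\<^sub>R norm y))"
    using integrable_hausdorff_pair[OF int_f', of "\<lambda>_. 1" 1] by simp
  have eq2: "AE x in lebesgue. AE y in lebesgue. f (x /\<^sub>R norm y) = f' (x /\<^sub>R norm (y :: real ^ 'n))"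
    by (rule AE_AE_dilation_norm[OF eq])
  have "AE x in lebesgue. integrable lborel (\<lambda>y. w y *\<^sub>R f' (x /\<^sub>R norm y))"
    by (rule AE_completion[OF lborel_pair.AE_integrable_fst[OF pair]])
  with eq2 show "AE x in lebesgue. integrable lebesgue (\<lambda>y. w y *\<^sub>R f (x /\<^sub>R norm y))"
  proof eventually_elim
    case (elim x)
    have "AE y in lebesgue. w y *\<^sub>R f (x /\<^sub>R norm y) = w y *\<^sub>R f' (x /\<^sub>R norm y)"
      using elim(1) by (rule eventually_mono) simp
    from integral_lebesgue_cong_AE(1)[OF this] elim(2) show ?case
      by (simp add: integrable_completion)
  qed
  define H where "H = (\<lambda>x. LINT y|lborel. w y *\<^sub>R f' (x /\<^sub>R norm y))"
  have H: "AE x in lebesgue. hausdorff_op w f x = H x"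
    using eq2
  proof eventually_elim
    case (elim x)
    have "AE y in lebesgue. w y *\<^sub>R f (x /\<^sub>R norm y) = w y *\<^sub>R f' (x /\<^sub>R norm y)"
      using elim by (rule eventually_mono) simp
    from integral_lebesgue_cong_AE(2)[OF this] show ?case
      by (simp add: hausdorff_op_def H_def integral_completion)
  qed
  have H_int: "integrable lborel H"
    unfolding H_def by (rule lborel_pair.integrable_fst[OF pair])
  have [measurable]: "H \<in> borel_measurable borel"
    using borel_measurable_integrable[OF H_int] by simp
  show "integrable lebesgue (hausdorff_op w f)"
    using integral_lebesgue_cong_AE(1)[OF H] H_int by (simp add: integrable_completion)
  have norm_pair: "integrable (lborel \<Otimes>\<^sub>M lborel) (\<lambda>(x, y). w y * norm (f' (x /\<^sub>R norm y)))"
    using integrable_norm[OF pair] w_nonneg by (simp add: case_prod_unfold)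
  \<comment> \<open>Here the factor |y|^n of the L1 bound arises; y = 0 is excluded because the
    dilation factor must be positive.\<close>
  have norm_dil: "(LINT x|lborel. w y * norm (f' (x /\<^sub>R norm y))) =
      norm y ^ CARD('n) * w y * (LINT x|lborel. norm (f' x))" if "y \<noteq> 0" for y
    using integral_dilation[of "\<lambda>x. norm (f' x)" "norm y"] that
    by (simp add: integral_completion measurable_completion)
  have "(LINT x|lebesgue. norm (hausdorff_op w f x)) = (LINT x|lebesgue. norm (H x))"
    by (rule integral_lebesgue_cong_AE(2)) (use H in \<open>rule eventually_mono, simp\<close>)
  also have "\<dots> = (LINT x|lborel. norm (H x))"
    by (rule integral_completion) simp
  also have "\<dots> \<le> (LINT x|lborel. LINT y|lborel. w y * norm (f' (x /\<^sub>R norm y)))"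
  proof (rule integral_mono)
    show "integrable lborel (\<lambda>x. LINT y|lborel. w y * norm (f' (x /\<^sub>R norm y)))"
      by (rule lborel_pair.integrable_fst[OF norm_pair])
    show "norm (H x) \<le> (LINT y|lborel. w y * norm (f' (x /\<^sub>R norm y)))" for x
      using integral_norm_bound[of lborel "\<lambda>y. w y *\<^sub>R f' (x /\<^sub>R norm y)"] w_nonneg
      by (simp add: H_def)
  qed (use H_int in auto)
  also have "\<dots> = (LINT y|lborel. LINT x|lborel. w y * norm (f' (x /\<^sub>R norm y)))"
    using lborel_pair.Fubini_integral[OF norm_pair] by simp
  also have "\<dots> = (LINT y|lborel. norm y ^ CARD('n) * w y * (LINT x|lborel. norm (f' x)))"
    by (rule integral_cong_AE)
       (use AE_lborel_singleton[of "0::real ^ 'n"] norm_dil in \<open>auto elim: eventually_mono\<close>)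
  also have "(LINT x|lborel. norm (f' x)) = (LINT x|lebesgue. norm (f' x))"
    by (rule integral_completion[symmetric]) simp
  also have "\<dots> = (LINT x|lebesgue. norm (f x))"
    by (rule integral_lebesgue_cong_AE(2)) (use eq in \<open>rule eventually_mono, simp\<close>)
  finally show "(LINT x|lebesgue. norm (hausdorff_op w f x)) \<le>
      (LINT y|lborel. norm y ^ CARD('n) * w y) * (LINT x|lebesgue. norm (f x))" by simp
  show "integrable lebesgue (\<lambda>y. w y *\<^sub>R (LINT x|lebesgue. f (x /\<^sub>R norm y) * \<psi> x)) \<and>
      (LINT x|lebesgue. hausdorff_op w f x * \<psi> x) =
        (LINT y|lebesgue. w y *\<^sub>R (LINT x|lebesgue. f (x /\<^sub>R norm y) * \<psi> x))"
    if [measurable]: "\<psi> \<in> borel_measurable borel" and M: "\<And>x. norm (\<psi> x) \<le> M"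
  proof -
    note pair' = integrable_hausdorff_pair[OF int_f' that]
    let ?J = "\<lambda>y. LINT x|lborel. w y *\<^sub>R (f' (x /\<^sub>R norm y) * \<psi> x)"
    have J: "w y *\<^sub>R (LINT x|lebesgue. f (x /\<^sub>R norm y) * \<psi> x) = ?J y" if "y \<noteq> 0" for y
    proof -
      have "AE x in lebesgue. f (x /\<^sub>R norm y) = f' (x /\<^sub>R norm y)"
        by (rule AE_dilation[OF eq]) (use that in simp)
      then have "(LINT x|lebesgue. f (x /\<^sub>R norm y) * \<psi> x) = (LINT x|lebesgue. f' (x /\<^sub>R norm y) * \<psi> x)"
        by (intro integral_lebesgue_cong_AE(2)) (rule eventually_mono, auto)
      also have "\<dots> = (LINT x|lborel. f' (x /\<^sub>R norm y) * \<psi> x)"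
        by (rule integral_completion) measurable
      finally show ?thesis by simp
    qed
    have J': "AE y in lebesgue. w y *\<^sub>R (LINT x|lebesgue. f (x /\<^sub>R norm y) * \<psi> x) = ?J y"
      using AE_completion[OF AE_lborel_singleton[of "0::real ^ 'n"]] by (rule eventually_mono) (rule J)
    have J_int: "integrable lborel ?J"
      by (rule lborel_pair.integrable_snd[OF pair'])
    then have [measurable]: "?J \<in> borel_measurable borel"
      using borel_measurable_integrable by fastforce
    have "integrable lebesgue (\<lambda>y. w y *\<^sub>R (LINT x|lebesgue. f (x /\<^sub>R norm y) * \<psi> x))"
      using integral_lebesgue_cong_AE(1)[OF J'] J_int by (simp add: integrable_completion)
    moreover have "(LINT x|lebesgue. hausdorff_op w f x * \<psi> x) =
        (LINT y|lebesgue. w y *\<^sub>R (LINT x|lebesgue. f (x /\<^sub>R norm y) * \<psi> x))"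
    proof -
      have "(LINT x|lebesgue. hausdorff_op w f x * \<psi> x) = (LINT x|lebesgue. H x * \<psi> x)"
        by (rule integral_lebesgue_cong_AE(2)) (use H in \<open>rule eventually_mono, simp\<close>)
      also have "\<dots> = (LINT x|lborel. H x * \<psi> x)"
        by (rule integral_completion) measurable
      also have "\<dots> = (LINT x|lborel. LINT y|lborel. w y *\<^sub>R (f' (x /\<^sub>R norm y) * \<psi> x))"
      proof (rule integral_cong_AE)
        show "AE x in lborel. H x * \<psi> x = (LINT y|lborel. w y *\<^sub>R (f' (x /\<^sub>R norm y) * \<psi> x))"
          using lborel_pair.AE_integrable_fst[OF pair]
        proof (rule eventually_mono)
          fix x assume "integrable lborel (\<lambda>y. w y *\<^sub>R f' (x /\<^sub>R norm y))"
          then show "H x * \<psi> x = (LINT y|lborel. w y *\<^sub>R (f' (x /\<^sub>R norm y) * \<psi> x))"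
            unfolding H_def by (subst integral_mult_left_zero[symmetric]) simp
        qed
      qed measurable
      also have "\<dots> = (LINT y|lborel. ?J y)"
        using lborel_pair.Fubini_integral[OF pair'] by simp
      also have "\<dots> = (LINT y|lebesgue. ?J y)"
        by (rule integral_completion[symmetric]) simp
      also have "\<dots> = (LINT y|lebesgue. w y *\<^sub>R (LINT x|lebesgue. f (x /\<^sub>R norm y) * \<psi> x))"
        by (rule integral_lebesgue_cong_AE(2)[OF J', symmetric])
      finally show ?thesis .
    qed
    ultimately show ?thesis ..
  qed
qed

end

subsection \<open>Sufficiency\<close>

text \<open>Fubini is used in both directions: with weight \<open>w\<close> against the derivative
  of \<phi> to reach the single dilates, and with weight \<open>v \<alpha>\<close> against \<phi>
  itself to reassemble them.\<close>

lemma has_weak_deriv_hausdorff_op: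
  fixes w :: "real ^ 'n::finite \<Rightarrow> real" and f g :: "real ^ 'n \<Rightarrow> 'b::{real_normed_field, euclidean_space}"
  defines "v \<equiv> \<lambda>\<alpha> y. 1 / norm y ^ multi_order \<alpha> * w y"
  assumes [measurable]: "w \<in> borel_measurable borel" and w: "\<And>y. w y \<ge> 0"
    and int_w: "integrable lborel (\<lambda>y. norm y ^ CARD('n) * w y)"
    and int_v: "integrable lborel (\<lambda>y. norm y ^ CARD('n) * v \<alpha> y)"
    and fg: "has_weak_deriv \<alpha> f g" and f: "integrable lebesgue f" and g: "integrable lebesgue g"
  shows "has_weak_deriv \<alpha> (hausdorff_op w f) (hausdorff_op (v \<alpha>) g)"
  unfolding has_weak_deriv_def
proof (intro conjI allI impI)
  have [measurable]: "v \<alpha> \<in> borel_measurable borel" and v: "\<And>y. v \<alpha> y \<ge> 0"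
    using w by (auto simp: v_def)
  show "locally_integrable (hausdorff_op w f)" "locally_integrable (hausdorff_op (v \<alpha>) g)"
    using integrable_hausdorff_op[OF _ w int_w f] integrable_hausdorff_op[OF _ v int_v g]
    by (auto intro: integrable_imp_locally_integrable)
  fix \<phi> :: "real ^ 'n \<Rightarrow> 'b" assume \<phi>: "test_function \<phi>"
  then have D: "test_function (multi_deriv \<alpha> \<phi>)"
    unfolding multi_deriv_eq_foldr by (rule test_function_foldr_partial_deriv)
  obtain M where M: "\<And>x. norm (\<phi> x) \<le> M" using test_function_bounded[OF \<phi>] by blast
  obtain M' where M': "\<And>x. norm (multi_deriv \<alpha> \<phi> x) \<le> M'" using test_function_bounded[OF D] by blast
  have "(LINT x|lebesgue. hausdorff_op w f x * multi_deriv \<alpha> \<phi> x) =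
      (LINT y|lebesgue. w y *\<^sub>R (LINT x|lebesgue. f (x /\<^sub>R norm y) * multi_deriv \<alpha> \<phi> x))"
    using integral_hausdorff_op_mult[OF _ w int_w f test_function_measurable[OF D] M'] by simp
  also have "\<dots> = (LINT y|lebesgue. (- 1) ^ multi_order \<alpha> *
      (v \<alpha> y *\<^sub>R (LINT x|lebesgue. g (x /\<^sub>R norm y) * \<phi> x)))"
  proof (rule integral_lebesgue_cong_AE(2), rule eventually_mono)
    show "AE y in lebesgue. y \<noteq> (0 :: real ^ 'n)"
      by (rule AE_completion[OF AE_lborel_singleton])
    fix y :: "real ^ 'n" assume "y \<noteq> 0"
    then show "w y *\<^sub>R (LINT x|lebesgue. f (x /\<^sub>R norm y) * multi_deriv \<alpha> \<phi> x) =
      (- 1) ^ multi_order \<alpha> * (v \<alpha> y *\<^sub>R (LINT x|lebesgue. g (x /\<^sub>R norm y) * \<phi> x))"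
      using has_weak_deriv_dilation[OF fg \<phi>, of "norm y"] by (simp add: v_def mult.commute)
  qed
  also have "\<dots> = (- 1) ^ multi_order \<alpha> *
      (LINT y|lebesgue. v \<alpha> y *\<^sub>R (LINT x|lebesgue. g (x /\<^sub>R norm y) * \<phi> x))"
    by (rule integral_mult_right_zero)
  also have "(LINT y|lebesgue. v \<alpha> y *\<^sub>R (LINT x|lebesgue. g (x /\<^sub>R norm y) * \<phi> x)) =
      (LINT x|lebesgue. hausdorff_op (v \<alpha>) g x * \<phi> x)"
    using integral_hausdorff_op_mult[OF _ v int_v g test_function_measurable[OF \<phi>] M] by simp
  finally show "(LINT x|lebesgue. hausdorff_op w f x * multi_deriv \<alpha> \<phi> x) =
      (- 1) ^ multi_order \<alpha> * (LINT x|lebesgue. hausdorff_op (v \<alpha>) g x * \<phi> x)" .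
qed

text \<open>The extreme orders 0 and k thus control all orders between them: the first dominates for
  r >= 1, the second for 0 < r < 1. At r = 0 the convention 1 / 0 = 0 keeps the inequality
  true.\<close>

lemma inverse_power_le_1_plus:
  fixes r :: real
  assumes "r \<ge> 0" "j \<le> k"
  shows "1 / r ^ j \<le> 1 + 1 / r ^ k"
proof (cases "r \<ge> 1")
  case True
  then have "1 / r ^ j \<le> 1" "1 / r ^ k \<ge> 0" by (auto simp: divide_le_eq)
  then show ?thesis by linarith
next
  case False
  show ?thesis
  proof (cases "r = 0")
    case True
    then show ?thesis by (cases j) auto
  next
    case False
    with \<open>\<not> r \<ge> 1\<close> assms have "1 / r ^ j \<le> 1 / r ^ k"
      by (intro divide_left_mono power_decreasing) auto
    then show ?thesis by simp
  qed
qed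

text \<open>One constant \<open>C\<close> dominates the weighted integral of every order up to k, so
  it also bounds the operator after summation over the multi-indices.\<close>

lemma hausdorff_sobolev:
  fixes w :: "real ^ 'n::finite \<Rightarrow> real" and k :: nat and f :: "real ^ 'n \<Rightarrow> 'b::{real_normed_field, euclidean_space}"
  defines "v \<equiv> \<lambda>\<alpha> y. 1 / norm y ^ multi_order \<alpha> * w y"
    and "C \<equiv> LINT y|lborel. norm y ^ CARD('n) * (1 + 1 / norm y ^ k) * w y"
  assumes [measurable]: "w \<in> borel_measurable borel" and w: "\<And>y. w y \<ge> 0"
    and fin: "(\<integral>\<^sup>+ y. ennreal (norm y ^ CARD('n) * (1 + 1 / norm y ^ k) * w y) \<partial>lborel) < \<infinity>"
    and f: "f \<in> sobolev k"
  shows hausdorff_sobolev_weak_deriv: "multi_order \<alpha> \<le> k \<Longrightarrow>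
      AE x in lebesgue. integrable lebesgue (\<lambda>y. v \<alpha> y *\<^sub>R weak_deriv \<alpha> f (x /\<^sub>R norm y)) \<and>
        weak_deriv \<alpha> (hausdorff_op w f) x = hausdorff_op (v \<alpha>) (weak_deriv \<alpha> f) x"
    and hausdorff_op_sobolev: "hausdorff_op w f \<in> sobolev k"
    and sobolev_norm_hausdorff_op: "sobolev_norm k (hausdorff_op w f) \<le> C * sobolev_norm k f"
    and hausdorff_sobolev_converges: "AE x in lebesgue. integrable lebesgue (\<lambda>y. w y *\<^sub>R f (x /\<^sub>R norm y))"
proof -
  have meas_v[measurable]: "v \<alpha> \<in> borel_measurable borel" and v: "\<And>y. v \<alpha> y \<ge> 0" for \<alpha>
    using w by (auto simp: v_def)
  have int_C: "integrable lborel (\<lambda>y. norm y ^ CARD('n) * (1 + 1 / norm y ^ k) * w y)"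
    using fin w by (intro integrableI_nonneg) auto
  have le: "norm y ^ CARD('n) * (1 / norm y ^ j * w y) \<le> norm y ^ CARD('n) * (1 + 1 / norm y ^ k) * w y"
    if "j \<le> k" for j y
    using mult_left_mono[OF mult_right_mono[OF inverse_power_le_1_plus[OF norm_ge_zero that, of y] w[of y]],
        of "norm y ^ CARD('n)"] by (simp only: mult.assoc) simp
  have int_j: "integrable lborel (\<lambda>y. norm y ^ CARD('n) * (1 / norm y ^ j * w y))" if "j \<le> k" for j
    by (rule Bochner_Integration.integrable_bound[OF int_C])
       (use le[OF that] w in \<open>auto simp: abs_mult intro!: AE_I2 order_trans[OF _ abs_ge_self]\<close>)
  have int_w: "integrable lborel (\<lambda>y. norm y ^ CARD('n) * w y)"
    using int_j[of 0] by simp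
  have int_v: "integrable lborel (\<lambda>y. norm y ^ CARD('n) * v \<alpha> y)" if "multi_order \<alpha> \<le> k" for \<alpha>
    unfolding v_def by (rule int_j[OF that])
  have v_le: "(LINT y|lborel. norm y ^ CARD('n) * v \<alpha> y) \<le> C" if "multi_order \<alpha> \<le> k" for \<alpha>
    unfolding C_def by (rule integral_mono[OF int_v[OF that] int_C]) (use le[OF that] in \<open>simp add: v_def\<close>)
  have f_int: "integrable lebesgue f" using f by (simp add: sobolev_def)
  note wd = sobolev_weak_deriv[OF f]
  have H: "has_weak_deriv \<alpha> (hausdorff_op w f) (hausdorff_op (v \<alpha>) (weak_deriv \<alpha> f))"
    if "multi_order \<alpha> \<le> k" for \<alpha>
    unfolding v_def
    by (rule has_weak_deriv_hausdorff_op) (use w int_w int_v that wd f_int in \<open>auto simp: v_def\<close>)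
  have H_int: "integrable lebesgue (hausdorff_op (v \<alpha>) (weak_deriv \<alpha> f))" if "multi_order \<alpha> \<le> k" for \<alpha>
    by (rule integrable_hausdorff_op[OF meas_v v int_v[OF that] wd(2)[OF that]])
  have H_eq: "AE x in lebesgue. weak_deriv \<alpha> (hausdorff_op w f) x = hausdorff_op (v \<alpha>) (weak_deriv \<alpha> f) x"
    if "multi_order \<alpha> \<le> k" for \<alpha>
    by (rule has_weak_deriv_unique[OF has_weak_deriv_weak_deriv[OF H[OF that]] H[OF that]])
  show "AE x in lebesgue. integrable lebesgue (\<lambda>y. v \<alpha> y *\<^sub>R weak_deriv \<alpha> f (x /\<^sub>R norm y)) \<and>
        weak_deriv \<alpha> (hausdorff_op w f) x = hausdorff_op (v \<alpha>) (weak_deriv \<alpha> f) x"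
    if "multi_order \<alpha> \<le> k"
    using hausdorff_converges[OF meas_v v int_v[OF that] wd(2)[OF that]] H_eq[OF that]
    by (rule AE_conjI)
  show "hausdorff_op w f \<in> sobolev k"
    unfolding sobolev_def using integrable_hausdorff_op[OF _ w int_w f_int] H H_int by auto
  show "AE x in lebesgue. integrable lebesgue (\<lambda>y. w y *\<^sub>R f (x /\<^sub>R norm y))"
    using hausdorff_converges[OF _ w int_w f_int] by simp
  have "(LINT x|lebesgue. norm (weak_deriv \<alpha> (hausdorff_op w f) x)) \<le>
      C * (LINT x|lebesgue. norm (weak_deriv \<alpha> f x))" if "multi_order \<alpha> \<le> k" for \<alpha>
  proof -
    have "(LINT x|lebesgue. norm (weak_deriv \<alpha> (hausdorff_op w f) x)) =
        (LINT x|lebesgue. norm (hausdorff_op (v \<alpha>) (weak_deriv \<alpha> f) x))"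
      by (rule integral_lebesgue_cong_AE(2)) (use H_eq[OF that] in \<open>rule eventually_mono, simp\<close>)
    also have "\<dots> \<le> (LINT y|lborel. norm y ^ CARD('n) * v \<alpha> y) * (LINT x|lebesgue. norm (weak_deriv \<alpha> f x))"
      by (rule hausdorff_op_L1_bound[OF meas_v v int_v[OF that] wd(2)[OF that]])
    also have "\<dots> \<le> C * (LINT x|lebesgue. norm (weak_deriv \<alpha> f x))"
      by (intro mult_right_mono v_le[OF that] integral_nonneg_AE) auto
    finally show ?thesis .
  qed
  then show "sobolev_norm k (hausdorff_op w f) \<le> C * sobolev_norm k f"
    unfolding sobolev_norm_def sum_distrib_left by (intro sum_mono) auto
qed

subsection \<open>Necessity\<close>

lemma test_function_integrable:
  fixes \<phi> :: "real ^ 'n::finite \<Rightarrow> 'b::{banach, second_countable_topology}"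
  shows "test_function \<phi> \<Longrightarrow> integrable lborel \<phi>"
  using integrable_lborel_bounded_support smooth_continuous unfolding test_function_iff by blast

text \<open>Repeated integration by parts makes the classical derivatives weak ones; this places the
  witnesses for necessity in the Sobolev space and names their derivatives.\<close>

lemma has_weak_deriv_tensor:
  fixes v :: "'b::{real_normed_field, euclidean_space}"
  assumes F: "\<And>i. deriv_chain (F i)"
    and supp: "\<And>i t. t \<notin> cbox (a $ i) (b $ i) \<Longrightarrow> F i 0 t = 0"
  shows "has_weak_deriv \<alpha> (\<lambda>x. tensor (\<lambda>i. F i 0) x *\<^sub>R v) (\<lambda>x. tensor (\<lambda>i. F i (\<alpha> i)) x *\<^sub>R v)"
    and "test_function (\<lambda>x. tensor (\<lambda>i. F i (\<alpha> i)) x *\<^sub>R v)"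
    and "(\<lambda>x. tensor (\<lambda>i. F i 0) x *\<^sub>R v) \<in> sobolev k"
proof -
  let ?f = "\<lambda>x. tensor (\<lambda>i. F i 0) x *\<^sub>R v" and ?g = "\<lambda>\<alpha> x. tensor (\<lambda>i. F i (\<alpha> i)) x *\<^sub>R v"
  have f: "test_function ?f" by (rule test_function_tensor[of F a b, OF F supp])
  have g_eq: "?g \<alpha> = multi_deriv \<alpha> ?f" for \<alpha>
    using multi_deriv_tensor[of F \<alpha> "\<lambda>_. 0" v, OF F] by simp
  have g: "test_function (?g \<alpha>)" for \<alpha>
    by (subst g_eq, subst multi_deriv_eq_foldr) (rule test_function_foldr_partial_deriv[OF f])
  then show "test_function (?g \<alpha>)" .
  have int: "integrable lebesgue h" if "test_function h" for h :: "real ^ 'a \<Rightarrow> 'b"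
    using test_function_integrable[OF that] test_function_measurable[OF that]
    by (simp add: integrable_completion)
  have wd: "has_weak_deriv \<alpha> ?f (?g \<alpha>)" for \<alpha>
    unfolding has_weak_deriv_def
  proof (intro conjI allI impI)
    show "locally_integrable ?f" "locally_integrable (?g \<alpha>)"
      by (intro integrable_imp_locally_integrable int f g)+
    fix \<phi> :: "real ^ 'a \<Rightarrow> 'b" assume \<phi>: "test_function \<phi>"
    have D: "test_function (multi_deriv \<alpha> \<phi>)"
      unfolding multi_deriv_eq_foldr by (rule test_function_foldr_partial_deriv[OF \<phi>])
    have [measurable]: "?f \<in> borel_measurable borel" "?g \<alpha> \<in> borel_measurable borel"
      "\<phi> \<in> borel_measurable borel" "multi_deriv \<alpha> \<phi> \<in> borel_measurable borel"
      by (intro test_function_measurable f g \<phi> D)+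
    have "(LINT x|lebesgue. ?f x * multi_deriv \<alpha> \<phi> x) = (LINT x|lborel. ?f x * multi_deriv \<alpha> \<phi> x)"
      by (rule integral_completion) measurable
    also have "\<dots> = (- 1) ^ multi_order \<alpha> * (LINT x|lborel. ?g \<alpha> x * \<phi> x)"
      using integral_tensor_foldr_partial_deriv[of F \<phi> "\<lambda>_. 0" v "multi_list \<alpha>", OF F \<phi>]
      by (simp add: multi_deriv_eq_foldr length_multi_list count_multi_list)
    also have "(LINT x|lborel. ?g \<alpha> x * \<phi> x) = (LINT x|lebesgue. ?g \<alpha> x * \<phi> x)"
      by (rule integral_completion[symmetric]) measurable
    finally show "(LINT x|lebesgue. ?f x * multi_deriv \<alpha> \<phi> x) =
        (- 1) ^ multi_order \<alpha> * (LINT x|lebesgue. ?g \<alpha> x * \<phi> x)" .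
  qed
  then show "has_weak_deriv \<alpha> ?f (?g \<alpha>)" .
  show "?f \<in> sobolev k"
    unfolding sobolev_def using int[OF f] wd int[OF g] by blast
qed

lemma nn_integral_pos_on_box_neq_0:
  fixes g :: "'a::euclidean_space \<Rightarrow> ennreal"
  assumes [measurable]: "g \<in> borel_measurable borel" and pos: "\<And>x. x \<in> box a b \<Longrightarrow> g x > 0"
    and "box a b \<noteq> {}"
  shows "(\<integral>\<^sup>+x. g x \<partial>lborel) \<noteq> 0"
proof
  assume "(\<integral>\<^sup>+x. g x \<partial>lborel) = 0"
  then have "AE x in lborel. g x = 0"
    by (subst (asm) nn_integral_0_iff_AE) auto
  then have "AE x in lborel. x \<notin> box a b"
    by (rule eventually_mono) (use pos in force)
  then have "box a b \<in> null_sets lborel"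
    by (subst AE_iff_null_sets) auto
  then have "negligible (box a b)"
    by (simp add: negligible_iff_null_sets null_sets_completionI)
  then show False using assms(3) open_not_negligible[OF open_box] by blast
qed

text \<open>Both necessity arguments read the weight off this product: if the left side is finite
  and \<open>E\<close> has nonzero integral, the first factor is finite.\<close>

lemma nn_integral_hausdorff_kernel:
  fixes w E :: "real ^ 'n::finite \<Rightarrow> ennreal"
  assumes [measurable]: "w \<in> borel_measurable borel" "E \<in> borel_measurable borel"
  shows "(\<integral>\<^sup>+y. (\<integral>\<^sup>+x. w y * E (x /\<^sub>R norm y) \<partial>lborel) \<partial>lborel) =
    (\<integral>\<^sup>+y. ennreal (norm y ^ CARD('n)) * w y \<partial>lborel) * (\<integral>\<^sup>+x. E x \<partial>lborel)"
proof -
  have "(\<integral>\<^sup>+y. (\<integral>\<^sup>+x. w y * E (x /\<^sub>R norm y) \<partial>lborel) \<partial>lborel) =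
      (\<integral>\<^sup>+y. ennreal (norm y ^ CARD('n)) * w y * (\<integral>\<^sup>+x. E x \<partial>lborel) \<partial>lborel)"
  proof (rule nn_integral_cong_AE, rule eventually_mono[OF AE_lborel_singleton[of 0]])
    fix y :: "real ^ 'n" assume "y \<noteq> 0"
    then show "(\<integral>\<^sup>+x. w y * E (x /\<^sub>R norm y) \<partial>lborel) =
        ennreal (norm y ^ CARD('n)) * w y * (\<integral>\<^sup>+x. E x \<partial>lborel)"
      using nn_integral_dilation[of E "norm y"] by (simp add: nn_integral_cmult mult_ac)
  qed
  also have "\<dots> = (\<integral>\<^sup>+y. ennreal (norm y ^ CARD('n)) * w y \<partial>lborel) * (\<integral>\<^sup>+x. E x \<partial>lborel)"
    by (rule nn_integral_multc) measurable
  finally show ?thesis .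
qed

text \<open>The endpoints may move with m, as for boxes that exhaust a half-space. A distance
  \<delta> from both endpoints bounds the bump from below by an expression without the endpoints,
  which tends to 1.\<close>

lemma bump_tendsto_1:
  assumes "\<delta> > 0" and ev: "\<forall>\<^sub>F m in sequentially. a m + \<delta> \<le> t \<and> t \<le> b m - \<delta>"
  shows "(\<lambda>m. bump (1 / real (Suc m)) (a m) (b m) t) \<longlonglongrightarrow> 1"
proof (rule tendsto_sandwich[where h="\<lambda>_. 1"])
  have "(\<lambda>m. exp (- (1 / real (Suc m)) / \<delta>) * exp (- (1 / real (Suc m)) / \<delta>)) \<longlonglongrightarrow> exp (- 0 / \<delta>) * exp (- 0 / \<delta>)"
    using assms(1) LIMSEQ_inverse_real_of_nat by (intro tendsto_intros) (auto simp: inverse_eq_divide)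
  then show "(\<lambda>m. exp (- (1 / real (Suc m)) / \<delta>) * exp (- (1 / real (Suc m)) / \<delta>)) \<longlonglongrightarrow> 1" by simp
  show "\<forall>\<^sub>F m in sequentially. exp (- (1 / real (Suc m)) / \<delta>) * exp (- (1 / real (Suc m)) / \<delta>)
      \<le> bump (1 / real (Suc m)) (a m) (b m) t"
    using ev
  proof eventually_elim
    case (elim m)
    have "- (1 / real (Suc m)) / \<delta> \<le> - (1 / real (Suc m)) / s" if "\<delta> \<le> s" for s
      using that assms(1) by (intro divide_left_mono_neg) auto
    from this[of "t - a m"] this[of "b m - t"] elim assms(1) show ?case
      by (auto simp: bump_def simp del: of_nat_Suc intro!: mult_mono)
  qed
qed (auto intro!: always_eventually bump_le_1)

text \<open>For nonnegative \<open>fr\<close> nothing cancels: the norm of the operator's value is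
  the integral of the kernel, so integrability of the image is a finite Tonelli integral.\<close>

lemma hausdorff_bounded_imp_L1_condition:
  fixes w :: "real ^ 'n::finite \<Rightarrow> real"
  assumes [measurable]: "w \<in> borel_measurable borel" and w: "\<And>y. w y \<ge> 0"
    and bdd: "hausdorff_bounded_on_sobolev TYPE('b::{real_normed_field, euclidean_space}) k w"
  shows "(\<integral>\<^sup>+y. ennreal (norm y ^ CARD('n)) * ennreal (w y) \<partial>lborel) < \<infinity>"
proof -
  obtain B where B: "deriv_chain B" "B 0 = bump 1 (- 1) 1" using bump_deriv_chain[of 1] by fastforce
  define fr where "fr = tensor (\<lambda>_::'n. bump 1 (- 1) 1)"
  define f where "f = (\<lambda>x. fr x *\<^sub>R (1::'b))"
  have "(\<lambda>x. tensor (\<lambda>_::'n. B 0) x *\<^sub>R (1::'b)) \<in> sobolev k"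
    by (rule has_weak_deriv_tensor(3)[where F="\<lambda>_. B" and a="\<chi> i. - 1" and b="\<chi> i. 1"])
       (auto simp: B bump_def)
  then have f: "f \<in> sobolev k" by (simp add: f_def fr_def B)
  have "test_function (\<lambda>x. tensor (\<lambda>_::'n. B 0) x *\<^sub>R (1::real))"
    by (rule test_function_tensor[where F="\<lambda>_. B" and a="\<chi> i. - 1" and b="\<chi> i. 1"])
       (auto simp: B bump_def)
  then have "test_function (\<lambda>x. fr x *\<^sub>R (1::real))" by (simp add: fr_def B)
  from test_function_measurable[OF this] have [measurable]: "fr \<in> borel_measurable borel" by simp
  have fr: "fr x \<ge> 0" for x unfolding fr_def tensor_def by (intro prod_nonneg) (simp add: bump_nonneg)
  have conv: "AE x in lebesgue. integrable lebesgue (\<lambda>y. w y *\<^sub>R f (x /\<^sub>R norm y))"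
    and Hf: "integrable lebesgue (hausdorff_op w f)"
    using bdd f unfolding hausdorff_bounded_on_sobolev_def sobolev_def by auto
  \<comment> \<open>The assumed absolute convergence is essential: a divergent Bochner integral has
    the value 0 by default, and the equality would fail.\<close>
  have "AE x in lborel. (\<integral>\<^sup>+y. ennreal (w y) * ennreal (fr (x /\<^sub>R norm y)) \<partial>lborel) = ennreal (norm (hausdorff_op w f x))"
    using conv[unfolded AE_completion_iff]
  proof (rule eventually_mono)
    fix x :: "real ^ 'n" assume *: "integrable lebesgue (\<lambda>y. w y *\<^sub>R f (x /\<^sub>R norm y))"
    have eq: "w y *\<^sub>R f (x /\<^sub>R norm y) = (w y * fr (x /\<^sub>R norm y)) *\<^sub>R 1" for y
      by (simp add: f_def)
    from integrable_norm[OF *] have int: "integrable lborel (\<lambda>y. w y * fr (x /\<^sub>R norm y))"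
      unfolding eq using w fr by (simp add: integrable_completion abs_mult)
    have "hausdorff_op w f x = (LINT y|lebesgue. (w y * fr (x /\<^sub>R norm y)) *\<^sub>R 1)"
      unfolding hausdorff_op_def eq ..
    also have "\<dots> = (LINT y|lborel. (w y * fr (x /\<^sub>R norm y)) *\<^sub>R 1)"
      by (rule integral_completion) measurable
    also have "\<dots> = (LINT y|lborel. w y * fr (x /\<^sub>R norm y)) *\<^sub>R 1"
      using int by (rule integral_scaleR_left)
    finally have "norm (hausdorff_op w f x) = (LINT y|lborel. w y * fr (x /\<^sub>R norm y))"
      using w fr by (simp add: integral_nonneg_AE)
    then show "(\<integral>\<^sup>+y. ennreal (w y) * ennreal (fr (x /\<^sub>R norm y)) \<partial>lborel) = ennreal (norm (hausdorff_op w f x))"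
      using nn_integral_eq_integral[OF int] w fr by (simp add: ennreal_mult)
  qed
  then have "(\<integral>\<^sup>+x. (\<integral>\<^sup>+y. ennreal (w y) * ennreal (fr (x /\<^sub>R norm y)) \<partial>lborel) \<partial>lborel) =
      (\<integral>\<^sup>+x. ennreal (norm (hausdorff_op w f x)) \<partial>lborel)"
    by (rule nn_integral_cong_AE)
  also have "\<dots> < \<infinity>"
    using Hf unfolding integrable_iff_bounded nn_integral_completion by simp
  also have "(\<integral>\<^sup>+x. (\<integral>\<^sup>+y. ennreal (w y) * ennreal (fr (x /\<^sub>R norm y)) \<partial>lborel) \<partial>lborel) =
      (\<integral>\<^sup>+y. (\<integral>\<^sup>+x. ennreal (w y) * ennreal (fr (x /\<^sub>R norm y)) \<partial>lborel) \<partial>lborel)"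
    by (rule lborel_pair.Fubini'[symmetric]) measurable
  also have "\<dots> = (\<integral>\<^sup>+y. ennreal (norm y ^ CARD('n)) * ennreal (w y) \<partial>lborel) * (\<integral>\<^sup>+x. ennreal (fr x) \<partial>lborel)"
    by (rule nn_integral_hausdorff_kernel) measurable
  finally have fin: "(\<integral>\<^sup>+y. ennreal (norm y ^ CARD('n)) * ennreal (w y) \<partial>lborel) * (\<integral>\<^sup>+x. ennreal (fr x) \<partial>lborel) < \<infinity>" .
  have "(\<integral>\<^sup>+x. ennreal (fr x) \<partial>lborel) \<noteq> 0"
  proof (rule nn_integral_pos_on_box_neq_0)
    show "box (\<chi> i. - 1) (\<chi> i. (1 :: real)) \<noteq> ({} :: (real ^ 'n) set)"
      by (auto simp: interval_ne_empty_cart)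
    show "ennreal (fr x) > 0" if "x \<in> box (\<chi> i. - 1) (\<chi> i. 1)" for x
      using that unfolding fr_def tensor_def by (auto simp: mem_box_cart intro!: prod_pos bump_pos)
  qed measurable
  with fin show ?thesis by (auto simp: ennreal_mult_less_top)
qed

lemma hausdorff_bounded_imp_top_order_condition:
  fixes w :: "real ^ 'n::finite \<Rightarrow> real"
  assumes [measurable]: "w \<in> borel_measurable borel" and w: "\<And>y. w y \<ge> 0"
    and bdd: "hausdorff_bounded_on_sobolev TYPE('b::{real_normed_field, euclidean_space}) k w"
  shows "(\<integral>\<^sup>+y. ennreal (norm y ^ CARD('n)) * ennreal (1 / norm y ^ k * w y) \<partial>lborel) < \<infinity>"
proof -
  \<comment> \<open>The case of order 0 comes first because it justifies Fubini for the signed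
    integrands below.\<close>
  have int_w: "integrable lborel (\<lambda>y. norm y ^ CARD('n) * w y)"
    using hausdorff_bounded_imp_L1_condition[OF _ w bdd] w
    by (intro integrableI_nonneg) (auto simp: ennreal_mult)
  \<comment> \<open>Any coordinate will serve as the direction of differentiation.\<close>
  obtain l :: 'n where True by simp
  obtain B where B: "deriv_chain B" "B 0 = bump 1 (- 1) 1" using bump_deriv_chain[of 1] by fastforce
  obtain U R where U: "deriv_chain U" "\<And>t. \<bar>t\<bar> > R \<Longrightarrow> U 0 t = 0" "\<And>t. t > 0 \<Longrightarrow> U k t \<ge> 0"
    "\<And>t. 0 < t \<Longrightarrow> t < 1 \<Longrightarrow> U k t > 0"
    using deriv_chain_one_signed[of k] by blast
  define F where "F = (\<lambda>i. if i = l then U else B)"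
  define \<alpha> where "\<alpha> = (\<lambda>i. if i = l then k else 0)"
  define D where "D = tensor (\<lambda>i. F i (\<alpha> i))"
  define f where "f = (\<lambda>x. tensor (\<lambda>i. F i 0) x *\<^sub>R (1::'b))"
  have ord: "multi_order \<alpha> = k" by (simp add: multi_order_def \<alpha>_def)
  have chain: "deriv_chain (F i)" for i using U B by (simp add: F_def)
  \<comment> \<open>One cube for all factors: \<open>B\<close> lives on [-1, 1] and \<open>U\<close>
    on [-R, R].\<close>
  have supp: "F i 0 t = 0" if "t \<notin> cbox ((\<chi> i. - max 1 R) $ i) ((\<chi> i. max 1 R) $ i)" for i t
    using that U(2)[of t] by (auto simp: F_def B bump_def split: if_splits)
  note wd = has_weak_deriv_tensor[of F "\<chi> i. - max 1 R" "\<chi> i. max 1 R", OF chain supp]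
  have f: "f \<in> sobolev k" and f_wd: "has_weak_deriv \<alpha> f (\<lambda>x. D x *\<^sub>R 1)"
    unfolding f_def D_def using wd(3)[of 1 k] wd(1)[of \<alpha> 1] by blast+
  have f_int: "integrable lebesgue f" using f by (simp add: sobolev_def)
  have D_test: "test_function (\<lambda>x. D x *\<^sub>R (1::real))" unfolding D_def by (rule wd)
  have D_cont: "continuous_on UNIV D"
    using D_test smooth_continuous[of "\<lambda>x. D x *\<^sub>R (1::real)" UNIV] by (simp add: test_function_iff)
  have [measurable]: "D \<in> borel_measurable borel"
    using borel_measurable_continuous_onI[OF D_cont] .
  have D_nonneg: "D x \<ge> 0" if "x $ l > 0" for x
    unfolding D_def tensor_def F_def \<alpha>_def
    by (intro prod_nonneg) (use that U(3) in \<open>auto simp: B bump_nonneg\<close>)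
  have D_pos: "D x > 0" if "0 < x $ l" "x $ l < 1" "\<And>i. i \<noteq> l \<Longrightarrow> \<bar>x $ i\<bar> < 1" for x
    unfolding D_def tensor_def F_def \<alpha>_def
    by (intro prod_pos) (use that U(4) in \<open>auto simp: B abs_less_iff intro!: bump_pos\<close>)
  have "hausdorff_op w f \<in> sobolev k"
    using bdd f by (auto simp: hausdorff_bounded_on_sobolev_def)
  then obtain g where g: "has_weak_deriv \<alpha> (hausdorff_op w f) g" and g_int: "integrable lebesgue g"
    using ord by (auto simp: sobolev_def)
  \<comment> \<open>The boxes, (0, m) in direction \<open>l\<close> and (-m, m) in the others,
    exhaust the open half-space.\<close>
  define a where "a = (\<lambda>m. \<chi> i. if i = l then 0 else - real m)"
  define b where "b = (\<lambda>m. \<chi> i::'n. real m)"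
  define \<phi> where "\<phi> = (\<lambda>m. tensor (\<lambda>i. bump (1 / real (Suc m)) (a m $ i) (b m $ i)))"
  have \<phi>_test: "test_function (\<lambda>x. \<phi> m x *\<^sub>R v)" for m and v :: "'c::real_normed_vector"
    unfolding \<phi>_def by (rule bump_tensor_test_function) simp
  have \<phi>_cont: "continuous_on UNIV (\<phi> m)" for m
    using \<phi>_test[of m "1::real"] smooth_continuous[of "\<lambda>x. \<phi> m x *\<^sub>R (1::real)" UNIV] by (simp add: test_function_iff)
  have [measurable]: "\<phi> m \<in> borel_measurable borel" for m
    using borel_measurable_continuous_onI[OF \<phi>_cont] .
  have \<phi>_bounds: "0 \<le> \<phi> m x" "\<phi> m x \<le> 1" for m x
    unfolding \<phi>_def by (rule bump_tensor_bounds; simp)+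
  have \<phi>_0: "\<phi> m x = 0" if "\<not> x $ l > 0" for m x
    unfolding \<phi>_def
    by (rule bump_tensor_bounds(3)) (use that in \<open>auto simp: mem_box_cart a_def intro!: exI[of _ l]\<close>)
  have \<phi>_lim: "(\<lambda>m. \<phi> m x) \<longlonglongrightarrow> 1" if "x $ l > 0" for x
  proof -
    have "(\<lambda>m. bump (1 / real (Suc m)) (a m $ i) (b m $ i) (x $ i)) \<longlonglongrightarrow> 1" for i
    proof (rule bump_tendsto_1)
      \<comment> \<open>In direction \<open>l\<close> the lower end stays at 0, so the distance to
        it is only \<open>x $ l\<close>; every other face recedes and is eventually at distance at
        least 1.\<close>
      show "0 < min 1 (x $ l)" using that by simp
      obtain N :: nat where N: "\<bar>x $ i\<bar> + 1 \<le> real N" using real_arch_simple by blast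
      show "\<forall>\<^sub>F m in sequentially. a m $ i + min 1 (x $ l) \<le> x $ i \<and> x $ i \<le> b m $ i - min 1 (x $ l)"
      proof (rule eventually_sequentiallyI)
        fix m assume "N \<le> m"
        then have "\<bar>x $ i\<bar> + 1 \<le> real m" using N by linarith
        then show "a m $ i + min 1 (x $ l) \<le> x $ i \<and> x $ i \<le> b m $ i - min 1 (x $ l)"
          by (auto simp: a_def b_def)
      qed
    qed
    then have "(\<lambda>m. \<phi> m x) \<longlonglongrightarrow> (\<Prod>i\<in>(UNIV::'n set). 1)"
      unfolding \<phi>_def tensor_def by (intro tendsto_prod)
    then show ?thesis by simp
  qed
  define h where "h = (\<lambda>m x y. ennreal (1 / norm y ^ k * w y * (D (x /\<^sub>R norm y) * \<phi> m x)))"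
  have [measurable]: "(\<lambda>(x, y). h m x y) \<in> borel_measurable (borel \<Otimes>\<^sub>M borel)" for m
    unfolding h_def by measurable
  \<comment> \<open>The bound is uniform in m: the double integral is the absolute value of the
    pairing of \<open>g\<close> with a test function whose values lie between 0 and 1.\<close>
  have bound: "(\<integral>\<^sup>+y. (\<integral>\<^sup>+x. h m x y \<partial>lborel) \<partial>lborel) \<le> ennreal (LINT x|lebesgue. norm (g x))" for m
  proof -
    let ?J = "\<lambda>y. LINT x|lborel. D (x /\<^sub>R norm y) * \<phi> m x"
    let ?v = "\<lambda>y. 1 / norm y ^ k * w y"
    obtain R where R: "\<And>x. norm x > R \<Longrightarrow> \<phi> m x = 0"
      using \<phi>_test[of m "1::real"] by (auto simp: test_function_iff)
    have J_int: "integrable lborel (\<lambda>x. D (x /\<^sub>R norm y) * \<phi> m x)" for y :: "real ^ 'n"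
    proof (rule integrable_lborel_bounded_support)
      show "continuous_on UNIV (\<lambda>x. D (x /\<^sub>R norm y) * \<phi> m x)"
        by (intro continuous_on_mult \<phi>_cont continuous_on_compose2[OF D_cont] continuous_intros) auto
    qed (use R in auto)
    \<comment> \<open>Wherever \<open>D (x /\<^sub>R norm y)\<close> could be negative,
      \<open>x $ l\<close> is not positive and the test function vanishes.\<close>
    have nonneg: "0 \<le> D (x /\<^sub>R norm y) * \<phi> m x" if "y \<noteq> 0" for x y :: "real ^ 'n"
      using \<phi>_0[of x m] \<phi>_bounds[of m x] D_nonneg[of "x /\<^sub>R norm y"] that
      by (cases "x $ l > 0") auto
    have J_nonneg: "?J y \<ge> 0" if "y \<noteq> 0" for y :: "real ^ 'n"
      using nonneg[OF that] by (intro integral_nonneg_AE) auto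
    have inner: "(\<integral>\<^sup>+x. h m x y \<partial>lborel) = ennreal (?v y * ?J y)" if "y \<noteq> 0" for y :: "real ^ 'n"
    proof -
      have "(\<integral>\<^sup>+x. h m x y \<partial>lborel) = (\<integral>\<^sup>+x. ennreal (?v y) * ennreal (D (x /\<^sub>R norm y) * \<phi> m x) \<partial>lborel)"
        unfolding h_def using w nonneg[OF that] by (intro nn_integral_cong ennreal_mult) auto
      also have "\<dots> = ennreal (?v y) * (\<integral>\<^sup>+x. ennreal (D (x /\<^sub>R norm y) * \<phi> m x) \<partial>lborel)"
        by (rule nn_integral_cmult) measurable
      also have "(\<integral>\<^sup>+x. ennreal (D (x /\<^sub>R norm y) * \<phi> m x) \<partial>lborel) = ennreal (?J y)"
        by (rule nn_integral_eq_integral[OF J_int]) (use nonneg[OF that] in auto)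
      finally show ?thesis using ennreal_mult[of "?v y" "?J y"] w J_nonneg[OF that] by simp
    qed
    let ?\<phi> = "\<lambda>x. \<phi> m x *\<^sub>R (1::'b)"
    have T: "test_function ?\<phi>" by (rule \<phi>_test)
    have DT: "test_function (multi_deriv \<alpha> ?\<phi>)"
      unfolding multi_deriv_eq_foldr by (rule test_function_foldr_partial_deriv[OF T])
    obtain M where M: "\<And>x. norm (multi_deriv \<alpha> ?\<phi> x) \<le> M" using test_function_bounded[OF DT] by blast
    have A: "integrable lebesgue (\<lambda>y. w y *\<^sub>R (LINT x|lebesgue. f (x /\<^sub>R norm y) * multi_deriv \<alpha> ?\<phi> x))"
      "(LINT x|lebesgue. hausdorff_op w f x * multi_deriv \<alpha> ?\<phi> x) =
        (LINT y|lebesgue. w y *\<^sub>R (LINT x|lebesgue. f (x /\<^sub>R norm y) * multi_deriv \<alpha> ?\<phi> x))"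
      using integral_hausdorff_op_mult[OF _ w int_w f_int test_function_measurable[OF DT] M] by auto
    have nz: "AE y in lebesgue. y \<noteq> (0 :: real ^ 'n)"
      by (rule AE_completion[OF AE_lborel_singleton])
    have eq: "AE y in lebesgue. w y *\<^sub>R (LINT x|lebesgue. f (x /\<^sub>R norm y) * multi_deriv \<alpha> ?\<phi> x) =
        ((?v y * ?J y) *\<^sub>R (- 1) ^ k)"
      using nz
    proof (rule eventually_mono)
      fix y :: "real ^ 'n" assume "y \<noteq> 0"
      then have "(LINT x|lebesgue. f (x /\<^sub>R norm y) * multi_deriv \<alpha> ?\<phi> x) =
          (- 1) ^ k * ((1 / norm y ^ k) *\<^sub>R (LINT x|lebesgue. (D (x /\<^sub>R norm y) * \<phi> m x) *\<^sub>R 1))"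
        using has_weak_deriv_dilation[OF f_wd T, of "norm y"] ord by (simp add: mult.commute)
      also have "(LINT x|lebesgue. (D (x /\<^sub>R norm y) * \<phi> m x) *\<^sub>R (1::'b)) =
          (LINT x|lborel. (D (x /\<^sub>R norm y) * \<phi> m x) *\<^sub>R 1)"
        by (rule integral_completion) measurable
      also have "\<dots> = ?J y *\<^sub>R 1"
        using J_int by (rule integral_scaleR_left)
      finally show "w y *\<^sub>R (LINT x|lebesgue. f (x /\<^sub>R norm y) * multi_deriv \<alpha> ?\<phi> x) =
          ((?v y * ?J y) *\<^sub>R (- 1) ^ k)"
        by (simp add: mult_ac)
    qed
    have int1: "integrable lebesgue (\<lambda>y. (?v y * ?J y) *\<^sub>R ((- 1) ^ k :: 'b))"
      using A(1) integral_lebesgue_cong_AE(1)[OF eq] by simp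
    \<comment> \<open>Taking norms leads from the values in the scalar field back to the real
      integrand and removes the sign (-1)^k; this works because that integrand is nonnegative off y
      = 0.\<close>
    have "integrable lebesgue (\<lambda>y. norm ((?v y * ?J y) *\<^sub>R ((- 1) ^ k :: 'b)))"
      by (rule integrable_norm[OF int1])
    moreover have "AE y in lebesgue. norm ((?v y * ?J y) *\<^sub>R ((- 1) ^ k :: 'b)) = ?v y * ?J y"
      using nz by (rule eventually_mono) (use w J_nonneg in \<open>simp add: norm_power\<close>)
    ultimately have int2: "integrable lebesgue (\<lambda>y. ?v y * ?J y)"
      by (subst (asm) integral_lebesgue_cong_AE(1))
    have "(LINT x|lebesgue. hausdorff_op w f x * multi_deriv \<alpha> ?\<phi> x) = (- 1) ^ k * (LINT x|lebesgue. g x * ?\<phi> x)"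
      using g T ord by (auto simp: has_weak_deriv_def)
    moreover have "(LINT x|lebesgue. hausdorff_op w f x * multi_deriv \<alpha> ?\<phi> x) =
        (LINT y|lebesgue. ?v y * ?J y) *\<^sub>R (- 1) ^ k"
      unfolding A(2) integral_lebesgue_cong_AE(2)[OF eq] by (rule integral_scaleR_left) (rule int2)
    ultimately have "norm ((LINT y|lebesgue. ?v y * ?J y) *\<^sub>R ((- 1) ^ k :: 'b)) =
        norm ((- 1) ^ k * (LINT x|lebesgue. g x * ?\<phi> x))" by simp
    then have "\<bar>LINT y|lebesgue. ?v y * ?J y\<bar> = norm (LINT x|lebesgue. g x * ?\<phi> x)"
      by (simp add: norm_mult norm_power)
    also have "\<dots> \<le> (LINT x|lebesgue. norm (g x * ?\<phi> x))"
      by (rule integral_norm_bound)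
    also have "\<dots> \<le> (LINT x|lebesgue. norm (g x))"
    proof (rule integral_mono)
      show "integrable lebesgue (\<lambda>x. norm (g x * ?\<phi> x))"
        by (intro integrable_norm integrable_mult_test_function T integrable_imp_locally_integrable g_int)
      show "norm (g x * ?\<phi> x) \<le> norm (g x)" for x
        using \<phi>_bounds[of m x] by (simp add: mult_left_le_one_le)
    qed (use g_int in auto)
    finally have le: "(LINT y|lebesgue. ?v y * ?J y) \<le> (LINT x|lebesgue. norm (g x))" by linarith
    have "(\<integral>\<^sup>+y. (\<integral>\<^sup>+x. h m x y \<partial>lborel) \<partial>lborel) = (\<integral>\<^sup>+y. (\<integral>\<^sup>+x. h m x y \<partial>lborel) \<partial>lebesgue)"
      by (rule nn_integral_completion[symmetric])
    also have "\<dots> = (\<integral>\<^sup>+y. ennreal (?v y * ?J y) \<partial>lebesgue)"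
      by (rule nn_integral_cong_AE) (use nz inner in \<open>auto elim: eventually_mono\<close>)
    also have "\<dots> = ennreal (LINT y|lebesgue. ?v y * ?J y)"
      by (rule nn_integral_eq_integral[OF int2])
         (use nz in \<open>rule eventually_mono, use w J_nonneg in auto\<close>)
    also have "\<dots> \<le> ennreal (LINT x|lebesgue. norm (g x))"
      by (rule ennreal_leI[OF le])
    finally show ?thesis .
  qed
  define E where "E = (\<lambda>z. ennreal (D z) * indicator {z. z $ l > 0} z)"
  have [measurable]: "E \<in> borel_measurable borel"
    unfolding E_def by measurable
  have "(\<integral>\<^sup>+y. ennreal (norm y ^ CARD('n)) * ennreal (1 / norm y ^ k * w y) \<partial>lborel) * (\<integral>\<^sup>+x. E x \<partial>lborel) =
      (\<integral>\<^sup>+y. (\<integral>\<^sup>+x. ennreal (1 / norm y ^ k * w y) * E (x /\<^sub>R norm y) \<partial>lborel) \<partial>lborel)"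
    by (rule nn_integral_hausdorff_kernel[symmetric]) measurable
  \<comment> \<open>For x in the half-space the test functions tend to 1. For the other x, x / |y|
    is outside the half-space too, so the left side is 0.\<close>
  also have "\<dots> \<le> (\<integral>\<^sup>+y. (\<integral>\<^sup>+x. liminf (\<lambda>m. h m x y) \<partial>lborel) \<partial>lborel)"
  proof (rule nn_integral_mono_AE, rule eventually_mono[OF AE_lborel_singleton[of 0]], rule nn_integral_mono)
    fix x y :: "real ^ 'n" assume "y \<noteq> 0"
    show "ennreal (1 / norm y ^ k * w y) * E (x /\<^sub>R norm y) \<le> liminf (\<lambda>m. h m x y)"
    proof (cases "x $ l > 0")
      case True
      have "(\<lambda>m. h m x y) \<longlonglongrightarrow> ennreal (1 / norm y ^ k * w y * (D (x /\<^sub>R norm y) * 1))"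
        unfolding h_def by (intro tendsto_ennrealI tendsto_mult tendsto_const \<phi>_lim[OF True])
      then have "liminf (\<lambda>m. h m x y) = ennreal (1 / norm y ^ k * w y * D (x /\<^sub>R norm y))"
        by (intro lim_imp_Liminf) auto
      also have "\<dots> = ennreal (1 / norm y ^ k * w y) * E (x /\<^sub>R norm y)"
        using True \<open>y \<noteq> 0\<close> w D_nonneg[of "x /\<^sub>R norm y"] by (simp add: E_def ennreal_mult[symmetric])
      finally show ?thesis by simp
    qed (use \<open>y \<noteq> 0\<close> in \<open>auto simp: E_def zero_less_mult_iff\<close>)
  qed
  \<comment> \<open>Fatou's lemma is applied once to each of the two integrals, which leaves the
    bound that is uniform in m.\<close>
  also have "\<dots> \<le> (\<integral>\<^sup>+y. liminf (\<lambda>m. \<integral>\<^sup>+x. h m x y \<partial>lborel) \<partial>lborel)"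
    by (intro nn_integral_mono nn_integral_liminf) measurable
  also have "\<dots> \<le> liminf (\<lambda>m. \<integral>\<^sup>+y. (\<integral>\<^sup>+x. h m x y \<partial>lborel) \<partial>lborel)"
    by (intro nn_integral_liminf) measurable
  also have "\<dots> \<le> ennreal (LINT x|lebesgue. norm (g x))"
    by (rule order_trans[OF Liminf_mono Liminf_const[THEN eq_refl]]) (use bound in auto)
  also have "\<dots> < \<infinity>" by simp
  finally have fin: "(\<integral>\<^sup>+y. ennreal (norm y ^ CARD('n)) * ennreal (1 / norm y ^ k * w y) \<partial>lborel) * (\<integral>\<^sup>+x. E x \<partial>lborel) < \<infinity>" .
  have "(\<integral>\<^sup>+x. E x \<partial>lborel) \<noteq> 0"
  proof (rule nn_integral_pos_on_box_neq_0)
    show "box (\<chi> i. if i = l then 0 else - 1) (\<chi> i. (1 :: real)) \<noteq> ({} :: (real ^ 'n) set)"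
      by (auto simp: interval_ne_empty_cart)
    show "E x > 0" if "x \<in> box (\<chi> i. if i = l then 0 else - 1) (\<chi> i. 1)" for x
    proof -
      have x: "(if i = l then 0 else - 1) < x $ i" "x $ i < 1" for i
        using that by (auto simp: mem_box_cart)
      have "0 < x $ l" using x(1)[of l] by simp
      moreover have "D x > 0"
        by (rule D_pos) (use x(1)[of l] x(2) x(1) in \<open>auto simp: abs_less_iff\<close>, smt (verit) x(1))
      ultimately show ?thesis by (simp add: E_def)
    qed
  qed measurable
  with fin show ?thesis by (auto simp: ennreal_mult_less_top)
qed

lemma hausdorff_bounded_iff_borel:
  fixes w :: "real ^ 'n::finite \<Rightarrow> real"
  assumes [measurable]: "w \<in> borel_measurable borel" and w: "\<And>y. w y \<ge> 0"
  shows "hausdorff_bounded_on_sobolev TYPE('b::{real_normed_field, euclidean_space}) k w \<longleftrightarrow>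
      (\<integral>\<^sup>+ y. ennreal (norm y ^ CARD('n) * (1 + 1 / norm y ^ k) * w y) \<partial>lborel) < \<infinity>"
proof
  assume bdd: "hausdorff_bounded_on_sobolev TYPE('b) k w"
  have "(\<integral>\<^sup>+ y. ennreal (norm y ^ CARD('n) * (1 + 1 / norm y ^ k) * w y) \<partial>lborel) =
      (\<integral>\<^sup>+ y. ennreal (norm y ^ CARD('n)) * ennreal (w y) +
        ennreal (norm y ^ CARD('n)) * ennreal (1 / norm y ^ k * w y) \<partial>lborel)"
    using w by (intro nn_integral_cong) (simp add: ennreal_mult[symmetric] ennreal_plus[symmetric] algebra_simps del: ennreal_plus)
  also have "\<dots> = (\<integral>\<^sup>+ y. ennreal (norm y ^ CARD('n)) * ennreal (w y) \<partial>lborel) +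
      (\<integral>\<^sup>+ y. ennreal (norm y ^ CARD('n)) * ennreal (1 / norm y ^ k * w y) \<partial>lborel)"
    by (rule nn_integral_add) measurable
  also have "\<dots> < \<infinity>"
    using hausdorff_bounded_imp_L1_condition[OF assms bdd] hausdorff_bounded_imp_top_order_condition[OF assms bdd]
    by simp
  finally show "(\<integral>\<^sup>+ y. ennreal (norm y ^ CARD('n) * (1 + 1 / norm y ^ k) * w y) \<partial>lborel) < \<infinity>" .
next
  assume "(\<integral>\<^sup>+ y. ennreal (norm y ^ CARD('n) * (1 + 1 / norm y ^ k) * w y) \<partial>lborel) < \<infinity>"
  note suff = hausdorff_sobolev[OF assms this]
  show "hausdorff_bounded_on_sobolev TYPE('b) k w"
    unfolding hausdorff_bounded_on_sobolev_def using suff(2-4) by blast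
qed

theorem corollary1p4:
  fixes \<Phi> :: "real ^ 'n::finite \<Rightarrow> real" and k :: nat
  assumes "\<Phi> \<in> borel_measurable lebesgue" and "\<And>y. \<Phi> y \<ge> 0"
  shows "(hausdorff_bounded_on_sobolev TYPE('b::{real_normed_field, euclidean_space}) k \<Phi> \<longleftrightarrow>
      (\<integral>\<^sup>+ y. ennreal (norm y ^ CARD('n) * (1 + 1 / norm y ^ k) * \<Phi> y) \<partial>lebesgue) < \<infinity>) \<and>
    ((\<integral>\<^sup>+ y. ennreal (norm y ^ CARD('n) * (1 + 1 / norm y ^ k) * \<Phi> y) \<partial>lebesgue) < \<infinity> \<longrightarrow>
      (\<forall>f \<in> sobolev k :: (real ^ 'n \<Rightarrow> 'b) set. \<forall>\<alpha>. multi_order \<alpha> \<le> k \<longrightarrow>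
        (AE x in lebesgue.
          integrable lebesgue
            (\<lambda>y. (1 / norm y ^ multi_order \<alpha> * \<Phi> y) *\<^sub>R weak_deriv \<alpha> f (x /\<^sub>R norm y)) \<and>
          weak_deriv \<alpha> (hausdorff_op \<Phi> f) x =
            (LINT y|lebesgue.
              (1 / norm y ^ multi_order \<alpha> * \<Phi> y) *\<^sub>R weak_deriv \<alpha> f (x /\<^sub>R norm y)))))"
proof -
  obtain h where [measurable]: "h \<in> borel_measurable borel" and h: "AE y in lborel. \<Phi> y = h y"
    using completion_ex_borel_measurable_real[OF assms(1)] by auto
  \<comment> \<open>The Borel representative may be negative on a null set; truncation restores
    nonnegativity at every point, which the Borel results assume.\<close>
  define w where "w = (\<lambda>y. max 0 (h y))"
  have w_meas[measurable]: "w \<in> borel_measurable borel" unfolding w_def by measurable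
  have w: "w y \<ge> 0" for y by (simp add: w_def)
  have \<Phi>_w: "AE y in lebesgue. \<Phi> y = w y"
    using AE_completion[OF h]
  proof (rule eventually_mono)
    fix y assume "\<Phi> y = h y"
    then show "\<Phi> y = w y" using assms(2)[of y] by (simp add: w_def)
  qed
  have AE_eq: "AE y in lebesgue. (c y * \<Phi> y) *\<^sub>R F y = (c y * w y) *\<^sub>R F y" for c and F :: "real ^ 'n \<Rightarrow> 'b"
    using \<Phi>_w by (rule eventually_mono) simp
  note cong = integral_lebesgue_cong_AE[OF AE_eq]
  \<comment> \<open>Equality holds at every x, since the null set on which the two weights differ
    lies in the integration variable and does not depend on x.\<close>
  have op_eq: "hausdorff_op \<Phi> F = hausdorff_op w F" for F :: "real ^ 'n \<Rightarrow> 'b"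
    unfolding hausdorff_op_def using cong(2)[of "\<lambda>_. 1"] by simp
  have "hausdorff_bounded_on_sobolev TYPE('b) k \<Phi> \<longleftrightarrow> hausdorff_bounded_on_sobolev TYPE('b) k w"
    unfolding hausdorff_bounded_on_sobolev_def op_eq using cong(1)[of "\<lambda>_. 1"] by simp
  moreover have "(\<integral>\<^sup>+ y. ennreal (norm y ^ CARD('n) * (1 + 1 / norm y ^ k) * \<Phi> y) \<partial>lebesgue) =
      (\<integral>\<^sup>+ y. ennreal (norm y ^ CARD('n) * (1 + 1 / norm y ^ k) * w y) \<partial>lborel)"
  proof -
    have "(\<integral>\<^sup>+ y. ennreal (norm y ^ CARD('n) * (1 + 1 / norm y ^ k) * \<Phi> y) \<partial>lebesgue) =
        (\<integral>\<^sup>+ y. ennreal (norm y ^ CARD('n) * (1 + 1 / norm y ^ k) * w y) \<partial>lebesgue)"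
      by (rule nn_integral_cong_AE) (use \<Phi>_w in \<open>rule eventually_mono, simp\<close>)
    then show ?thesis by (simp only: nn_integral_completion)
  qed
  moreover have "AE x in lebesgue.
          integrable lebesgue
            (\<lambda>y. (1 / norm y ^ multi_order \<alpha> * \<Phi> y) *\<^sub>R weak_deriv \<alpha> f (x /\<^sub>R norm y)) \<and>
          weak_deriv \<alpha> (hausdorff_op \<Phi> f) x =
            (LINT y|lebesgue.
              (1 / norm y ^ multi_order \<alpha> * \<Phi> y) *\<^sub>R weak_deriv \<alpha> f (x /\<^sub>R norm y))"
    if "(\<integral>\<^sup>+ y. ennreal (norm y ^ CARD('n) * (1 + 1 / norm y ^ k) * w y) \<partial>lborel) < \<infinity>"
      and "f \<in> sobolev k" and "multi_order \<alpha> \<le> k" for f :: "real ^ 'n \<Rightarrow> 'b" and \<alpha>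
    using hausdorff_sobolev_weak_deriv[OF w_meas w that]
    unfolding op_eq cong hausdorff_op_def[of "\<lambda>y. 1 / norm y ^ multi_order \<alpha> * w y"] .
  ultimately show ?thesis
    using hausdorff_bounded_iff_borel[OF w_meas w, where 'b='b] by simp
qed

end
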